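(* For any $\boldsymbol{e}$-invariant partial type $\Sigma(x)$, there is a Lascar tuple in $\Sigma$ over $\boldsymbol{e}$, that is, a small tuple $b$ of realizations of $\Sigma$ such that $\operatorname{Autf}_{\mathrm L}(\Sigma,\boldsymbol{e})=\{\sigma\in\operatorname{Aut}_{\boldsymbol{e}}(\Sigma): b\equiv^{\mathrm L}_{\boldsymbol{e}}\sigma(b)\}$.
   Context: $T$ is a complete first-order theory with monster model $\mathfrak{C}$; "small" means of size less than the degree of saturation and strong homogeneity of $\mathfrak{C}$. All sets, tuples, ordinals, cardinals and (elementary sub)models considered are small. A hyperimaginary is an equivalence class $a_E$ of an $\emptyset$-type-definable equivalence relation $E$ on $\mathfrak{C}^\alpha$ ($\alpha$ a small ordinal), with representative $a$. $\boldsymbol{e}=a_E$ is a fixed arbitrary hyperimaginary and $\operatorname{Aut}_{\boldsymbol{e}}(\mathfrak{C})=\{f\in\operatorname{Aut}(\mathfrak{C}): f(\boldsymbol{e})=\boldsymbol{e}\text{ setwise}\}$. $\boldsymbol{e}\in\operatorname{dcl}(M)$ means every automorphism fixing $M$ pointwise fixes $\boldsymbol{e}$. $\operatorname{Autf}_{\mathrm L}(\mathfrak{C},\boldsymbol{e})$ is the (normal) subgroup of $\operatorname{Aut}_{\boldsymbol{e}}(\mathfrak{C})$ generated by those $f\in\operatorname{Aut}_{\boldsymbol{e}}(\mathfrak{C})$ that fix pointwise some model $M\models T$ with $\boldsymbol{e}\in\operatorname{dcl}(M)$. $c\equiv^{\mathrm L}_{\boldsymbol{e}} d$ means there is $f\in\operatorname{Autf}_{\mathrm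 L}(\mathfrak{C},\boldsymbol{e})$ with $f(c)=d$. $\Sigma(x)$ is a partial type, $x$ a possibly infinite tuple of variables; $\boldsymbol{e}$-invariant means that for $f\in\operatorname{Aut}_{\boldsymbol{e}}(\mathfrak{C})$, $b\models\Sigma$ iff $f(b)\models\Sigma$. $\Sigma(\mathfrak{C})$ is its solution set. A tuple of realizations of $\Sigma$ is a tuple $(b_i)_{i<\lambda}$ with each $b_i\models\Sigma$. $\operatorname{Aut}_{\boldsymbol{e}}(\Sigma)=\{f\upharpoonright\Sigma(\mathfrak{C}): f\in\operatorname{Aut}_{\boldsymbol{e}}(\mathfrak{C})\}$, and $\operatorname{Autf}_{\mathrm L}(\Sigma,\boldsymbol{e})$ is the normal subgroup of all $\sigma\in\operatorname{Aut}_{\boldsymbol{e}}(\Sigma)$ such that $b\equiv^{\mathrm L}_{\boldsymbol{e}}\sigma(b)$ for every cardinal $\lambda$ and every tuple $b=(b_i)_{i<\lambda}$ of realizations of $\Sigma$. *)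

theory Defs
  imports Main "HOL-Algebra.Bij" "HOL-Algebra.Generated_Groups"
begin

unbundle cardinal_syntax

section \<open>First-order logic\<close>

text \<open>
  A symbol is a pair of a name and an arity, so either set of symbols may be empty.
  The type \<^typ>\<open>'v\<close> of variables is a parameter; below it is always infinite, so that there are
  enough variables to quantify over.
\<close>

record ('f, 'r) language =
  fsyms :: "('f \<times> nat) set"
  rsyms :: "('r \<times> nat) set"

datatype ('f, 'v) trm = Var 'v | App 'f "('f, 'v) trm list"

datatype ('f, 'r, 'v) fm =
    Falsum
  | Equal "('f, 'v) trm" "('f, 'v) trm"
  | Pred 'r "('f, 'v) trm list"
  | Imp "('f, 'r, 'v) fm" "('f, 'r, 'v) fm"
  | All 'v "('f, 'r, 'v) fm"

abbreviation Neg :: "('f, 'r, 'v) fm \<Rightarrow> ('f, 'r, 'v) fm" where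
  "Neg \<phi> \<equiv> Imp \<phi> Falsum"

fun wf_trm :: "('f, 'r) language \<Rightarrow> ('f, 'v) trm \<Rightarrow> bool" where
  "wf_trm L (Var x) \<longleftrightarrow> True"
| "wf_trm L (App f ts) \<longleftrightarrow> (f, length ts) \<in> fsyms L \<and> (\<forall>t\<in>set ts. wf_trm L t)"

fun wf_fm :: "('f, 'r) language \<Rightarrow> ('f, 'r, 'v) fm \<Rightarrow> bool" where
  "wf_fm L Falsum \<longleftrightarrow> True"
| "wf_fm L (Equal s t) \<longleftrightarrow> wf_trm L s \<and> wf_trm L t"
| "wf_fm L (Pred r ts) \<longleftrightarrow> (r, length ts) \<in> rsyms L \<and> (\<forall>t\<in>set ts. wf_trm L t)"
| "wf_fm L (Imp \<phi> \<psi>) \<longleftrightarrow> wf_fm L \<phi> \<and> wf_fm L \<psi>"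
| "wf_fm L (All x \<phi>) \<longleftrightarrow> wf_fm L \<phi>"

fun fv_trm :: "('f, 'v) trm \<Rightarrow> 'v set" where
  "fv_trm (Var x) = {x}"
| "fv_trm (App f ts) = (\<Union>t\<in>set ts. fv_trm t)"

fun fv :: "('f, 'r, 'v) fm \<Rightarrow> 'v set" where
  "fv Falsum = {}"
| "fv (Equal s t) = fv_trm s \<union> fv_trm t"
| "fv (Pred r ts) = (\<Union>t\<in>set ts. fv_trm t)"
| "fv (Imp \<phi> \<psi>) = fv \<phi> \<union> fv \<psi>"
| "fv (All x \<phi>) = fv \<phi> - {x}"

record ('f, 'r, 'a) fo_structure =
  univ :: "'a set"
  fint :: "'f \<Rightarrow> 'a list \<Rightarrow> 'a"
  rint :: "'r \<Rightarrow> 'a list \<Rightarrow> bool"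

definition is_structure :: "('f, 'r) language \<Rightarrow> ('f, 'r, 'a) fo_structure \<Rightarrow> bool" where
  "is_structure L S \<longleftrightarrow> univ S \<noteq> {} \<and>
     (\<forall>(f, n)\<in>fsyms L. \<forall>xs. length xs = n \<and> set xs \<subseteq> univ S \<longrightarrow> fint S f xs \<in> univ S)"

fun val :: "('f, 'r, 'a) fo_structure \<Rightarrow> ('v \<Rightarrow> 'a) \<Rightarrow> ('f, 'v) trm \<Rightarrow> 'a" where
  "val S v (Var x) = v x"
| "val S v (App f ts) = fint S f (map (val S v) ts)"

fun sat :: "('f, 'r, 'a) fo_structure \<Rightarrow> ('v \<Rightarrow> 'a) \<Rightarrow> ('f, 'r, 'v) fm \<Rightarrow> bool" where
  "sat S v Falsum \<longleftrightarrow> False"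
| "sat S v (Equal s t) \<longleftrightarrow> val S v s = val S v t"
| "sat S v (Pred r ts) \<longleftrightarrow> rint S r (map (val S v) ts)"
| "sat S v (Imp \<phi> \<psi>) \<longleftrightarrow> (sat S v \<phi> \<longrightarrow> sat S v \<psi>)"
| "sat S v (All x \<phi>) \<longleftrightarrow> (\<forall>a\<in>univ S. sat S (v(x := a)) \<phi>)"

definition sentences :: "('f, 'r) language \<Rightarrow> ('f, 'r, nat) fm set" where
  "sentences L = {\<phi>. wf_fm L \<phi> \<and> fv \<phi> = {}}"

text \<open>
  Complete theories are taken deductively closed, so that the cardinality of the set \<^term>\<open>T\<close> is
  the usual \<open>|T| = |L| + \<aleph>\<^sub>0\<close>.  Consistency is not part of this definition: it comes from the
  model of \<^term>\<open>T\<close> that is required wherever the definition is used.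
\<close>

definition complete_theory :: "('f, 'r) language \<Rightarrow> ('f, 'r, nat) fm set \<Rightarrow> bool" where
  "complete_theory L T \<longleftrightarrow> T \<subseteq> sentences L \<and> (\<forall>\<phi>\<in>sentences L. \<phi> \<in> T \<or> Neg \<phi> \<in> T)"

definition models :: "('f, 'r, 'a) fo_structure \<Rightarrow> ('f, 'r, nat) fm set \<Rightarrow> bool" where
  "models S T \<longleftrightarrow> (\<forall>\<phi>\<in>T. \<forall>v. (\<forall>n. v n \<in> univ S) \<longrightarrow> sat S v \<phi>)"

text \<open>Elementary submodels of \<^term>\<open>S\<close>, given by their universe.\<close>

definition elem_submodel :: "('f, 'r) language \<Rightarrow> ('f, 'r, 'a) fo_structure \<Rightarrow> 'a set \<Rightarrow> bool" where
  "elem_submodel L S M \<longleftrightarrow> M \<subseteq> univ S \<and> is_structure L (S\<lparr>univ := M\<rparr>) \<and>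
     (\<forall>(\<phi> :: ('f, 'r, nat) fm) v. wf_fm L \<phi> \<and> (\<forall>n. v n \<in> M) \<longrightarrow>
        (sat (S\<lparr>univ := M\<rparr>) v \<phi> \<longleftrightarrow> sat S v \<phi>))"

definition Aut :: "('f, 'r) language \<Rightarrow> ('f, 'r, 'a) fo_structure \<Rightarrow> ('a \<Rightarrow> 'a) set" where
  "Aut L S = {f \<in> Bij (univ S).
     (\<forall>(g, n)\<in>fsyms L. \<forall>xs. length xs = n \<and> set xs \<subseteq> univ S \<longrightarrow>
        f (fint S g xs) = fint S g (map f xs)) \<and>
     (\<forall>(r, n)\<in>rsyms L. \<forall>xs. length xs = n \<and> set xs \<subseteq> univ S \<longrightarrow>
        (rint S r xs \<longleftrightarrow> rint S r (map f xs)))}"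


section \<open>Partial types\<close>

text \<open>
  Let \<^term>\<open>X\<close> be the index set of a tuple of variables and \<^term>\<open>A\<close> a set of parameters.
  A formula over \<^term>\<open>A\<close> in these variables is a formula whose free variables are of the form
  \<^term>\<open>Inl i\<close> with \<^term>\<open>i \<in> X\<close>, or \<^term>\<open>Inr a\<close> with \<^term>\<open>a \<in> A\<close>, the latter being
  interpreted by \<^term>\<open>a\<close> itself.
\<close>

definition solutions ::
  "('f, 'r, 'a) fo_structure \<Rightarrow> 'i set \<Rightarrow> ('f, 'r, 'i + 'a) fm set \<Rightarrow> ('i \<Rightarrow> 'a) set" where
  "solutions S X p = {b \<in> X \<rightarrow>\<^sub>E univ S. \<forall>\<phi>\<in>p. sat S (case_sum b id) \<phi>}"

definition partial_type_over ::
  "('f, 'r) language \<Rightarrow> ('f, 'r, 'a) fo_structure \<Rightarrow> 'i set \<Rightarrow> 'a set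
     \<Rightarrow> ('f, 'r, 'i + 'a) fm set \<Rightarrow> bool" where
  "partial_type_over L S X A p \<longleftrightarrow>
     (\<forall>\<phi>\<in>p. wf_fm L \<phi> \<and> fv \<phi> \<subseteq> Inl ` X \<union> Inr ` A) \<and>
     (\<forall>p0. p0 \<subseteq> p \<and> finite p0 \<longrightarrow> solutions S X p0 \<noteq> {})"


section \<open>Monster models\<close>

text \<open>
  A set is small if its cardinality is less than \<^term>\<open>\<kappa>\<close>.  Since \<^term>\<open>\<kappa>\<close> is a cardinal, its
  proper initial segments are exactly the small ordinals: the small ordinal \<open>\<alpha> < \<kappa>\<close> is given by an
  element of \<^term>\<open>Field \<kappa>\<close>, and the set of ordinals below it is \<^term>\<open>underS \<kappa> \<alpha>\<close>.
  Tuples of length \<open>\<alpha>\<close> are extensional functions on \<^term>\<open>underS \<kappa> \<alpha>\<close>.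
\<close>

definition small :: "'k rel \<Rightarrow> 'b set \<Rightarrow> bool" where
  "small \<kappa> A \<longleftrightarrow> |A| <o \<kappa>"

abbreviation tuples :: "'k rel \<Rightarrow> 'k \<Rightarrow> 'b set \<Rightarrow> ('k \<Rightarrow> 'b) set" where
  "tuples \<kappa> \<alpha> B \<equiv> underS \<kappa> \<alpha> \<rightarrow>\<^sub>E B"

text \<open>The image of a tuple of length \<open>\<alpha>\<close> under a map applied coordinatewise.\<close>

abbreviation app :: "'k rel \<Rightarrow> 'k \<Rightarrow> ('b \<Rightarrow> 'c) \<Rightarrow> ('k \<Rightarrow> 'b) \<Rightarrow> ('k \<Rightarrow> 'c)" where
  "app \<kappa> \<alpha> f b \<equiv> compose (underS \<kappa> \<alpha>) f b"

definition small_ordinal :: "'k rel \<Rightarrow> 'k \<Rightarrow> bool" where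
  "small_ordinal \<kappa> \<alpha> \<longleftrightarrow> \<alpha> \<in> Field \<kappa>"

definition small_cardinal :: "'k rel \<Rightarrow> 'k \<Rightarrow> bool" where
  "small_cardinal \<kappa> \<mu> \<longleftrightarrow> small_ordinal \<kappa> \<mu> \<and> Card_order (Restr \<kappa> (underS \<kappa> \<mu>))"

definition saturated :: "('f, 'r) language \<Rightarrow> 'k rel \<Rightarrow> ('f, 'r, 'a) fo_structure \<Rightarrow> bool" where
  "saturated L \<kappa> S \<longleftrightarrow>
     (\<forall>A p. A \<subseteq> univ S \<and> small \<kappa> A \<and> partial_type_over L S {0 :: nat} A p \<longrightarrow>
        solutions S {0} p \<noteq> {})"

definition elementary_map ::
  "('f, 'r) language \<Rightarrow> ('f, 'r, 'a) fo_structure \<Rightarrow> 'a set \<Rightarrow> ('a \<Rightarrow> 'a) \<Rightarrow> bool" where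
  "elementary_map L S A h \<longleftrightarrow> A \<subseteq> univ S \<and> h ` A \<subseteq> univ S \<and>
     (\<forall>(\<phi> :: ('f, 'r, nat) fm) v. wf_fm L \<phi> \<and> v ` fv \<phi> \<subseteq> A \<longrightarrow>
        (sat S v \<phi> \<longleftrightarrow> sat S (h \<circ> v) \<phi>))"

definition strongly_homogeneous ::
  "('f, 'r) language \<Rightarrow> 'k rel \<Rightarrow> ('f, 'r, 'a) fo_structure \<Rightarrow> bool" where
  "strongly_homogeneous L \<kappa> S \<longleftrightarrow>
     (\<forall>A h. small \<kappa> A \<and> elementary_map L S A h \<longrightarrow> (\<exists>f\<in>Aut L S. \<forall>a\<in>A. f a = h a))"

text \<open>
  The degree \<open>\<kappa>\<close> of saturation and strong homogeneity of a monster model has to be sufficiently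
  large.  The usual convention is adopted: \<open>\<kappa> > |T|\<close> is a strong limit cardinal.
\<close>

definition strong_limit :: "'k rel \<Rightarrow> bool" where
  "strong_limit \<kappa> \<longleftrightarrow> (\<forall>A \<subseteq> Field \<kappa>. small \<kappa> A \<longrightarrow> small \<kappa> (Pow A))"

definition monster_model ::
  "('f, 'r) language \<Rightarrow> ('f, 'r, nat) fm set \<Rightarrow> 'k rel \<Rightarrow> ('f, 'r, 'a) fo_structure \<Rightarrow> bool" where
  "monster_model L T \<kappa> C \<longleftrightarrow>
     Card_order \<kappa> \<and> small \<kappa> T \<and> strong_limit \<kappa> \<and>
     is_structure L C \<and> models C T \<and> saturated L \<kappa> C \<and> strongly_homogeneous L \<kappa> C"


section \<open>Hyperimaginaries\<close>

text \<open>
  The relation on \<open>C\<^sup>\<alpha>\<close> defined by a set of parameter-free formulas in the variables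
  \<open>x\<^sub>i\<close>, rendered \<^term>\<open>Inl i\<close>, and \<open>y\<^sub>i\<close>, rendered \<^term>\<open>Inr i\<close>.
\<close>

definition type_defined_rel ::
  "('f, 'r, 'a) fo_structure \<Rightarrow> 'k rel \<Rightarrow> 'k \<Rightarrow> ('f, 'r, 'k + 'k) fm set \<Rightarrow> ('k \<Rightarrow> 'a) rel" where
  "type_defined_rel C \<kappa> \<alpha> \<Theta> =
     {(a, b) \<in> tuples \<kappa> \<alpha> (univ C) \<times> tuples \<kappa> \<alpha> (univ C). \<forall>\<theta>\<in>\<Theta>. sat C (case_sum a b) \<theta>}"

definition type_definable_equiv ::
  "('f, 'r) language \<Rightarrow> ('f, 'r, 'a) fo_structure \<Rightarrow> 'k rel \<Rightarrow> 'k \<Rightarrow> ('k \<Rightarrow> 'a) rel \<Rightarrow> bool" where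
  "type_definable_equiv L C \<kappa> \<alpha> E \<longleftrightarrow> equiv (tuples \<kappa> \<alpha> (univ C)) E \<and>
     (\<exists>\<Theta> :: ('f, 'r, 'k + 'k) fm set.
        (\<forall>\<theta>\<in>\<Theta>. wf_fm L \<theta> \<and> fv \<theta> \<subseteq> Inl ` underS \<kappa> \<alpha> \<union> Inr ` underS \<kappa> \<alpha>) \<and>
        E = type_defined_rel C \<kappa> \<alpha> \<Theta>)"

definition hyperimaginary ::
  "('f, 'r) language \<Rightarrow> ('f, 'r, 'a) fo_structure \<Rightarrow> 'k rel \<Rightarrow> 'k \<Rightarrow> ('k \<Rightarrow> 'a) set \<Rightarrow> bool" where
  "hyperimaginary L C \<kappa> \<alpha> e \<longleftrightarrow> small_ordinal \<kappa> \<alpha> \<and>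
     (\<exists>E. type_definable_equiv L C \<kappa> \<alpha> E \<and> (\<exists>a\<in>tuples \<kappa> \<alpha> (univ C). e = E `` {a}))"

definition Aut_over ::
  "('f, 'r) language \<Rightarrow> ('f, 'r, 'a) fo_structure \<Rightarrow> 'k rel \<Rightarrow> 'k \<Rightarrow> ('k \<Rightarrow> 'a) set
     \<Rightarrow> ('a \<Rightarrow> 'a) set" where
  "Aut_over L C \<kappa> \<alpha> e = {f \<in> Aut L C. app \<kappa> \<alpha> f ` e = e}"

definition in_dcl ::
  "('f, 'r) language \<Rightarrow> ('f, 'r, 'a) fo_structure \<Rightarrow> 'k rel \<Rightarrow> 'k \<Rightarrow> ('k \<Rightarrow> 'a) set
     \<Rightarrow> 'a set \<Rightarrow> bool" where
  "in_dcl L C \<kappa> \<alpha> e M \<longleftrightarrow> (\<forall>f\<in>Aut L C. (\<forall>m\<in>M. f m = m) \<longrightarrow> app \<kappa> \<alpha> f ` e = e)"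


section \<open>Lascar strong automorphisms\<close>

definition AutfL ::
  "('f, 'r) language \<Rightarrow> ('f, 'r, 'a) fo_structure \<Rightarrow> 'k rel \<Rightarrow> 'k \<Rightarrow> ('k \<Rightarrow> 'a) set
     \<Rightarrow> ('a \<Rightarrow> 'a) set" where
  "AutfL L C \<kappa> \<alpha> e = generate (BijGroup (univ C))
     {f \<in> Aut_over L C \<kappa> \<alpha> e.
        \<exists>M. elem_submodel L C M \<and> small \<kappa> M \<and> in_dcl L C \<kappa> \<alpha> e M \<and> (\<forall>m\<in>M. f m = m)}"

text \<open>
  From here on, \<^term>\<open>p\<close> is the partial type \<open>\<Sigma>(x)\<close>, the tuple \<open>x\<close> of variables having length
  \<^term>\<open>\<beta>\<close>, and \<^term>\<open>\<mu>\<close>-tuples of realizations of \<open>\<Sigma>\<close> are tuples of tuples.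
\<close>

definition partial_type ::
  "('f, 'r) language \<Rightarrow> ('f, 'r, 'a) fo_structure \<Rightarrow> 'k rel \<Rightarrow> 'k
     \<Rightarrow> ('f, 'r, 'k + 'a) fm set \<Rightarrow> bool" where
  "partial_type L C \<kappa> \<beta> p \<longleftrightarrow> small_ordinal \<kappa> \<beta> \<and>
     (\<exists>A \<subseteq> univ C. small \<kappa> A \<and> partial_type_over L C (underS \<kappa> \<beta>) A p)"

abbreviation realizations ::
  "('f, 'r, 'a) fo_structure \<Rightarrow> 'k rel \<Rightarrow> 'k \<Rightarrow> ('f, 'r, 'k + 'a) fm set \<Rightarrow> ('k \<Rightarrow> 'a) set" where
  "realizations C \<kappa> \<beta> p \<equiv> solutions C (underS \<kappa> \<beta>) p"

definition invariant_type ::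
  "('f, 'r) language \<Rightarrow> ('f, 'r, 'a) fo_structure \<Rightarrow> 'k rel \<Rightarrow> 'k \<Rightarrow> ('k \<Rightarrow> 'a) set
     \<Rightarrow> 'k \<Rightarrow> ('f, 'r, 'k + 'a) fm set \<Rightarrow> bool" where
  "invariant_type L C \<kappa> \<alpha> e \<beta> p \<longleftrightarrow>
     (\<forall>f\<in>Aut_over L C \<kappa> \<alpha> e. \<forall>b\<in>tuples \<kappa> \<beta> (univ C).
        b \<in> realizations C \<kappa> \<beta> p \<longleftrightarrow> app \<kappa> \<beta> f b \<in> realizations C \<kappa> \<beta> p)"

text \<open>Lascar equivalence over \<^term>\<open>e\<close> of \<^term>\<open>\<mu>\<close>-tuples of \<^term>\<open>\<beta>\<close>-tuples.\<close>

definition lascar_equiv ::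
  "('f, 'r) language \<Rightarrow> ('f, 'r, 'a) fo_structure \<Rightarrow> 'k rel \<Rightarrow> 'k \<Rightarrow> ('k \<Rightarrow> 'a) set
     \<Rightarrow> 'k \<Rightarrow> 'k \<Rightarrow> ('k \<Rightarrow> 'k \<Rightarrow> 'a) \<Rightarrow> ('k \<Rightarrow> 'k \<Rightarrow> 'a) \<Rightarrow> bool" where
  "lascar_equiv L C \<kappa> \<alpha> e \<beta> \<mu> c d \<longleftrightarrow> (\<exists>f\<in>AutfL L C \<kappa> \<alpha> e. app \<kappa> \<mu> (app \<kappa> \<beta> f) c = d)"

definition Aut_type ::
  "('f, 'r) language \<Rightarrow> ('f, 'r, 'a) fo_structure \<Rightarrow> 'k rel \<Rightarrow> 'k \<Rightarrow> ('k \<Rightarrow> 'a) set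
     \<Rightarrow> 'k \<Rightarrow> ('f, 'r, 'k + 'a) fm set \<Rightarrow> (('k \<Rightarrow> 'a) \<Rightarrow> ('k \<Rightarrow> 'a)) set" where
  "Aut_type L C \<kappa> \<alpha> e \<beta> p =
     (\<lambda>f. restrict (app \<kappa> \<beta> f) (realizations C \<kappa> \<beta> p)) ` Aut_over L C \<kappa> \<alpha> e"

definition AutfL_type ::
  "('f, 'r) language \<Rightarrow> ('f, 'r, 'a) fo_structure \<Rightarrow> 'k rel \<Rightarrow> 'k \<Rightarrow> ('k \<Rightarrow> 'a) set
     \<Rightarrow> 'k \<Rightarrow> ('f, 'r, 'k + 'a) fm set \<Rightarrow> (('k \<Rightarrow> 'a) \<Rightarrow> ('k \<Rightarrow> 'a)) set" where
  "AutfL_type L C \<kappa> \<alpha> e \<beta> p = {\<sigma> \<in> Aut_type L C \<kappa> \<alpha> e \<beta> p.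
     \<forall>\<mu>. small_cardinal \<kappa> \<mu> \<longrightarrow>
       (\<forall>b\<in>tuples \<kappa> \<mu> (realizations C \<kappa> \<beta> p). lascar_equiv L C \<kappa> \<alpha> e \<beta> \<mu> b (app \<kappa> \<mu> \<sigma> b))}"

definition lascar_tuple ::
  "('f, 'r) language \<Rightarrow> ('f, 'r, 'a) fo_structure \<Rightarrow> 'k rel \<Rightarrow> 'k \<Rightarrow> ('k \<Rightarrow> 'a) set
     \<Rightarrow> 'k \<Rightarrow> ('f, 'r, 'k + 'a) fm set \<Rightarrow> 'k \<Rightarrow> ('k \<Rightarrow> 'k \<Rightarrow> 'a) \<Rightarrow> bool" where
  "lascar_tuple L C \<kappa> \<alpha> e \<beta> p \<mu> b \<longleftrightarrow>
     small_cardinal \<kappa> \<mu> \<and> b \<in> tuples \<kappa> \<mu> (realizations C \<kappa> \<beta> p) \<and>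
     AutfL_type L C \<kappa> \<alpha> e \<beta> p =
       {\<sigma> \<in> Aut_type L C \<kappa> \<alpha> e \<beta> p. lascar_equiv L C \<kappa> \<alpha> e \<beta> \<mu> b (app \<kappa> \<mu> \<sigma> b)}"

end

theory Submission
  imports Defs "HOL-Algebra.Free_Abelian_Groups"
begin

text \<open>
  Let \<open>U\<close> be the set of all coordinates of realizations of the partial type.  Whether a restriction
  of \<open>f\<close> to the realizations is Lascar strong depends on whether, on every small subset of \<open>U\<close>,
  \<open>f\<close> agrees with some Lascar strong automorphism.  A Lascar tuple exists because one small
  subset \<open>S\<^sub>0\<close> decides this for all others (\<open>ex_small_determining_set\<close>).

  The number of cosets of the Lascar strong automorphisms is small.  It would be natural to choose
  for each coset a tuple on which it fails to be Lascar strong, and to concatenate these tuples.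
  But a small number of small tuples need not be small altogether when \<open>\<kappa>\<close> is singular.
  Working with types instead of cosets makes finite witnesses possible.
  Fix a small model \<open>M\<close> that contains a representative of \<open>e\<close> (\<open>ex_tarski_vaught\<close>).
  If \<open>h\<close> fixes \<open>e\<close> and \<open>h(M)\<close> has the type of \<open>h'(M)\<close> over \<open>M\<close>, then \<open>h\<close> and \<open>h'\<close> differ by a
  Lascar strong automorphism (\<open>conjugate_if_same_type\<close> and \<open>quotient_in_Autf\<close>), and there are only a
  small number of types over \<open>M\<close> since \<open>\<kappa>\<close> is a strong limit.  A given type is the type of \<open>h'(M)\<close>
  for some \<open>h'\<close> that fixes \<open>S\<close> pointwise as soon as this holds for every finite part of \<open>S\<close>
  (\<open>compactness_fixing\<close>).  Hence each type that fails for some subset of \<open>U\<close> fails for a finite one,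
  and the union of one finite set for each failing type is the required \<open>S\<^sub>0\<close>.

  The compactness used here is the realization of types in a small number of variables
  (\<open>ex_realization\<close>), which follows from saturation for types in one variable.
\<close>

section \<open>Semantics and renaming of variables\<close>

lemma finite_fv_trm [simp]: "finite (fv_trm t)"
  by (induction t) auto

lemma finite_fv [simp]: "finite (fv \<phi>)"
  by (induction \<phi>) auto

lemma val_cong: "(\<And>x. x \<in> fv_trm t \<Longrightarrow> v x = w x) \<Longrightarrow> val S v t = val S w t"
proof (induction t)
  case (App f ts)
  then have "map (val S v) ts = map (val S w) ts" by (auto simp: map_eq_conv)
  then show ?case by (simp only: val.simps)
qed simp

lemma sat_cong: "(\<And>x. x \<in> fv \<phi> \<Longrightarrow> v x = w x) \<Longrightarrow> sat S v \<phi> \<longleftrightarrow> sat S w \<phi>"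
proof (induction \<phi> arbitrary: v w)
  case (Equal s t)
  then show ?case using val_cong[of s v w S] val_cong[of t v w S] by simp
next
  case (Pred r ts)
  then have "map (val S v) ts = map (val S w) ts" by (auto intro: val_cong simp: map_eq_conv)
  then show ?case by (simp only: sat.simps)
next
  case (Imp \<phi> \<psi>)
  then show ?case by (metis UnCI fv.simps(4) sat.simps(4))
next
  case (All x \<phi>)
  have "sat S (v(x := a)) \<phi> \<longleftrightarrow> sat S (w(x := a)) \<phi>" for a
    by (rule All.IH) (use All.prems in auto)
  then show ?case by simp
qed simp

lemma val_univ:
  assumes "is_structure L S" "wf_trm L t" "v ` fv_trm t \<subseteq> univ S"
  shows "val S v t \<in> univ S"
  using assms(2,3)
proof (induction t)
  case (App f ts)
  have "set (map (val S v) ts) \<subseteq> univ S" using App by fastforce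
  then show ?case using App.prems assms(1) unfolding is_structure_def by fastforce
qed auto

lemma val_map_trm: "val S u (map_trm id w t) = val S (\<lambda>x. u (w x)) t"
  by (induction t) (auto simp: comp_def intro!: arg_cong[of _ _ "fint S _"])

lemma fv_map_trm [simp]: "fv_trm (map_trm id w t) = w ` fv_trm t"
  by (induction t) auto

lemma wf_map_trm [simp]: "wf_trm L (map_trm id w t) \<longleftrightarrow> wf_trm L t"
  by (induction t) auto

text \<open>
  Which kind of variables a formula is written in does not matter, as long as there are infinitely
  many of them: the substitution may even identify free variables, and it does not capture any
  because some variable is always left for the next quantifier.  This connects the types of
  tuples below, whose variables are indices and parameters, with the formulas in numbered variables
  that the notion of an elementary map uses.
\<close>

lemma ex_substitution:
  fixes S :: "('f, 'r, 'a) fo_structure" and \<phi> :: "('f, 'r, 'v) fm" and w :: "'v \<Rightarrow> 'w"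
  assumes inf: "infinite (UNIV :: 'w set)" and "wf_fm L \<phi>"
  shows "\<exists>\<psi> :: ('f, 'r, 'w) fm. wf_fm L \<psi> \<and> fv \<psi> = w ` fv \<phi> \<and>
    (\<forall>u. sat S u \<psi> \<longleftrightarrow> sat S (\<lambda>x. u (w x)) \<phi>)"
  using assms(2)
proof (induction \<phi> arbitrary: w)
  case Falsum
  show ?case by (rule exI[of _ Falsum]) simp
next
  case (Equal s t)
  then show ?case
    by (intro exI[of _ "Equal (map_trm id w s) (map_trm id w t)"]) (auto simp: val_map_trm comp_def)
next
  case (Pred r ts)
  have "val S u \<circ> map_trm id w = val S (\<lambda>x. u (w x))" for u
    by (rule ext) (simp add: val_map_trm comp_def)
  then show ?case using Pred
    by (intro exI[of _ "Pred r (map (map_trm id w) ts)"]) (auto simp: comp_def simp del: map_eq_conv)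
next
  case (Imp \<phi>1 \<phi>2)
  then obtain \<psi>1 \<psi>2 :: "('f, 'r, 'w) fm" where
    "wf_fm L \<psi>1 \<and> fv \<psi>1 = w ` fv \<phi>1 \<and>
      (\<forall>u. sat S u \<psi>1 \<longleftrightarrow> sat S (\<lambda>x. u (w x)) \<phi>1)"
    "wf_fm L \<psi>2 \<and> fv \<psi>2 = w ` fv \<phi>2 \<and>
      (\<forall>u. sat S u \<psi>2 \<longleftrightarrow> sat S (\<lambda>x. u (w x)) \<phi>2)"
    by (metis wf_fm.simps(4))
  then show ?case by (intro exI[of _ "Imp \<psi>1 \<psi>2"]) auto
next
  case (All x \<phi>)
  \<comment> \<open>The bound variable is renamed to one that no free variable is sent to.\<close>
  obtain y where y: "y \<notin> w ` fv \<phi>"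
    using ex_new_if_finite[OF inf] by (metis finite_fv finite_imageI)
  obtain \<psi> :: "('f, 'r, 'w) fm" where \<psi>: "wf_fm L \<psi>" "fv \<psi> = w(x := y) ` fv \<phi>"
    "\<And>u. sat S u \<psi> \<longleftrightarrow> sat S (\<lambda>z. u ((w(x := y)) z)) \<phi>"
    using All.IH[of "w(x := y)"] All.prems by auto
  have "sat S (u(y := a)) \<psi> \<longleftrightarrow> sat S ((\<lambda>x. u (w x))(x := a)) \<phi>"
    for u a
    unfolding \<psi>(3) by (rule sat_cong) (use y in auto)
  moreover have "fv (All y \<psi>) = w ` fv (All x \<phi>)" using \<psi>(2) y by auto
  ultimately show ?case using \<psi>(1) by (intro exI[of _ "All y \<psi>"]) auto
qed

abbreviation Conj :: "('f, 'r, 'v) fm \<Rightarrow> ('f, 'r, 'v) fm \<Rightarrow> ('f, 'r, 'v) fm" where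
  "Conj \<phi> \<psi> \<equiv> Neg (Imp \<phi> (Neg \<psi>))"

abbreviation Ex :: "'v \<Rightarrow> ('f, 'r, 'v) fm \<Rightarrow> ('f, 'r, 'v) fm" where
  "Ex x \<phi> \<equiv> Neg (All x (Neg \<phi>))"

lemma ex_conjunction:
  fixes S :: "('f, 'r, 'a) fo_structure" and P :: "('f, 'r, 'v) fm set"
  assumes "finite P" "\<forall>\<phi>\<in>P. wf_fm L \<phi>"
  shows "\<exists>\<psi>. wf_fm L \<psi> \<and> fv \<psi> = (\<Union>\<phi>\<in>P. fv \<phi>) \<and> 
    (\<forall>v. sat S v \<psi> \<longleftrightarrow> (\<forall>\<phi>\<in>P. sat S v \<phi>))"
  using assms
proof induction
  case empty
  show ?case by (rule exI[of _ "Neg Falsum"]) simp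
next
  case (insert \<phi> P)
  then obtain \<psi> :: "('f, 'r, 'v) fm" where "wf_fm L \<psi>" "fv \<psi> = (\<Union>\<phi>\<in>P. fv \<phi>)"
    "\<forall>v. sat S v \<psi> \<longleftrightarrow> (\<forall>\<phi>\<in>P. sat S v \<phi>)" by auto
  with insert.prems show ?case by (intro exI[of _ "Conj \<phi> \<psi>"]) auto
qed

lemma ex_projection:
  fixes S :: "('f, 'r, 'a) fo_structure" and \<phi> :: "('f, 'r, 'v) fm"
  assumes "finite Y" "wf_fm L \<phi>"
  shows "\<exists>\<psi>. wf_fm L \<psi> \<and> fv \<psi> = fv \<phi> - Y \<and>
    (\<forall>v. sat S v \<psi> \<longleftrightarrow> (\<exists>w. (\<forall>x\<in>Y. w x \<in> univ S) \<and> (\<forall>x. x \<notin> Y \<longrightarrow> w x = v x) \<and> sat S w \<phi>))"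
  using assms
proof induction
  case empty
  show ?case using empty by (intro exI[of _ \<phi>]) (simp flip: fun_eq_iff)
next
  case (insert y Y)
  then obtain \<psi> where \<psi>: "wf_fm L \<psi>" "fv \<psi> = fv \<phi> - Y"
    "\<And>v. sat S v \<psi> \<longleftrightarrow>
       (\<exists>w. (\<forall>x\<in>Y. w x \<in> univ S) \<and> (\<forall>x. x \<notin> Y \<longrightarrow> w x = v x) \<and> sat S w \<phi>)" by auto
  have "(\<exists>a\<in>univ S. sat S (v(y := a)) \<psi>) \<longleftrightarrow>
      (\<exists>w. (\<forall>x\<in>insert y Y. w x \<in> univ S) \<and> (\<forall>x. x \<notin> insert y Y \<longrightarrow> w x = v x) \<and> sat S w \<phi>)"
    (is "?l \<longleftrightarrow> ?r") for v
  proof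
    assume ?l
    then obtain a w where a: "a \<in> univ S" "\<forall>x\<in>Y. w x \<in> univ S"
      "\<forall>x. x \<notin> Y \<longrightarrow> w x = (v(y := a)) x" "sat S w \<phi>" unfolding \<psi>(3) by blast
    then show ?r using insert.hyps by (intro exI[of _ w]) auto
  next
    assume ?r
    then obtain w where "\<forall>x\<in>insert y Y. w x \<in> univ S" "\<forall>x. x \<notin> insert y Y \<longrightarrow> w x = v x" "sat S w \<phi>"
      by blast
    then show ?l unfolding \<psi>(3) by (intro bexI[of _ "w y"] exI[of _ w]) auto
  qed
  then show ?case using \<psi>(1,2) by (intro exI[of _ "Ex y \<psi>"]) auto
qed

section \<open>Automorphisms and strong homogeneity\<close>

lemma Aut_Bij: "f \<in> Aut L S \<Longrightarrow> f \<in> Bij (univ S)"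
  by (simp add: Aut_def)

lemma Aut_mem: "f \<in> Aut L S \<Longrightarrow> a \<in> univ S \<Longrightarrow> f a \<in> univ S"
  using Aut_Bij Bij_imp_funcset by blast

lemma Aut_image: "f \<in> Aut L S \<Longrightarrow> f ` univ S = univ S"
  using Aut_Bij[of f L S] by (auto simp: Bij_def bij_betw_def)

lemma Aut_inj: "f \<in> Aut L S \<Longrightarrow> inj_on f (univ S)"
  using Aut_Bij[of f L S] by (auto simp: Bij_def bij_betw_def)

lemma val_Aut:
  assumes "is_structure L S" "f \<in> Aut L S" "wf_trm L t" "v ` fv_trm t \<subseteq> univ S"
  shows "val S (\<lambda>x. f (v x)) t = f (val S v t)"
  using assms(3,4)
proof (induction t)
  case (App g ts)
  have mem: "set (map (val S v) ts) \<subseteq> univ S"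
    using App.prems val_univ[OF assms(1)] by fastforce
  have "map (val S (\<lambda>x. f (v x))) ts = map f (map (val S v) ts)" using App by (auto simp: UN_subset_iff comp_def)
  moreover have "f (fint S g (map (val S v) ts)) = fint S g (map f (map (val S v) ts))"
    using assms(2) App.prems(1) mem unfolding Aut_def by fastforce
  ultimately show ?case by (simp only: val.simps)
qed simp

lemma sat_Aut:
  assumes "is_structure L S" "f \<in> Aut L S" "wf_fm L \<phi>" "v ` fv \<phi> \<subseteq> univ S"
  shows "sat S (\<lambda>x. f (v x)) \<phi> \<longleftrightarrow> sat S v \<phi>"
  using assms(3,4)
proof (induction \<phi> arbitrary: v)
  case (Equal s t)
  then have "val S v s \<in> univ S" "val S v t \<in> univ S"
    by (auto intro!: val_univ[OF assms(1)])
  then show ?case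
    using Equal.prems
    by (simp add: image_Un val_Aut[OF assms(1,2)] inj_on_eq_iff[OF Aut_inj[OF assms(2)]])
next
  case (Pred r ts)
  have "set (map (val S v) ts) \<subseteq> univ S"
    using Pred.prems val_univ[OF assms(1)] by fastforce
  then have "rint S r (map (val S v) ts) \<longleftrightarrow> rint S r (map f (map (val S v) ts))"
    using assms(2) Pred.prems unfolding Aut_def by fastforce
  moreover have "map (val S (\<lambda>x. f (v x))) ts = map f (map (val S v) ts)"
    using Pred.prems by (auto intro!: val_Aut[OF assms(1,2)])
  ultimately show ?case by (simp only: sat.simps)
next
  case (All x \<phi>)
  have "sat S ((\<lambda>y. f (v y))(x := f a)) \<phi> \<longleftrightarrow> sat S (v(x := a)) \<phi>" if "a \<in> univ S" for a
  proof -
    have "sat S (\<lambda>y. f ((v(x := a)) y)) \<phi> \<longleftrightarrow> sat S (v(x := a)) \<phi>"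
      by (rule All.IH) (use All.prems that in auto)
    moreover have "(\<lambda>y. f ((v(x := a)) y)) = (\<lambda>y. f (v y))(x := f a)" by auto
    ultimately show ?thesis by simp
  qed
  then have "(\<forall>b\<in>f ` univ S. sat S ((\<lambda>y. f (v y))(x := b)) \<phi>) \<longleftrightarrow> (\<forall>a\<in>univ S. sat S (v(x := a)) \<phi>)"
    by simp
  then show ?case by (simp add: Aut_image[OF assms(2)])
qed auto

lemma Aut_compose:
  assumes "is_structure L S" "f \<in> Aut L S" "g \<in> Aut L S"
  shows "compose (univ S) f g \<in> Aut L S"
proof -
  have 1: "map (compose (univ S) f g) xs = map f (map g xs)" "set (map g xs) \<subseteq> univ S"
    if "set xs \<subseteq> univ S" for xs
    using that Aut_mem[OF assms(3)] by (auto simp: compose_def)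
  have F: "fint S h xs \<in> univ S" if "(h, length xs) \<in> fsyms L" "set xs \<subseteq> univ S" for h xs
    using that assms(1) unfolding is_structure_def by fastforce
  show ?thesis
    unfolding Aut_def
  proof (intro CollectI conjI ballI, goal_cases)
    case 1
    show ?case using assms by (intro compose_Bij Aut_Bij)
  next
    case (2 z)
    then obtain h n where z: "z = (h, n)" by force
    have "compose (univ S) f g (fint S h xs) = fint S h (map (compose (univ S) f g) xs)"
      if xs: "length xs = n" "set xs \<subseteq> univ S" for xs
    proof -
      have "fint S h xs \<in> univ S" using xs 2 z F by simp
      then have "compose (univ S) f g (fint S h xs) = f (g (fint S h xs))" by (simp add: compose_def)
      also have "\<dots> = f (fint S h (map g xs))"
        using assms(3) xs 2 z unfolding Aut_def by fastforce
      also have "\<dots> = fint S h (map f (map g xs))"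
        using assms(2) 1(2)[OF xs(2)] xs(1) 2 z unfolding Aut_def by fastforce
      finally show ?thesis by (simp only: 1(1)[OF xs(2)])
    qed
    then show ?case using z by simp
  next
    case (3 z)
    then obtain h n where z: "z = (h, n)" by force
    have "rint S h xs \<longleftrightarrow> rint S h (map (compose (univ S) f g) xs)"
      if xs: "length xs = n" "set xs \<subseteq> univ S" for xs
    proof -
      have "rint S h xs \<longleftrightarrow> rint S h (map g xs)"
        using assms(3) xs 3 z unfolding Aut_def by fastforce
      also have "\<dots> \<longleftrightarrow> rint S h (map f (map g xs))"
        using assms(2) 1(2)[OF xs(2)] xs(1) 3 z unfolding Aut_def by fastforce
      finally show ?thesis by (simp only: 1(1)[OF xs(2)])
    qed
    then show ?case using z by simp
  qed
qed

abbreviation Aut_inv :: "('f, 'r, 'a) fo_structure \<Rightarrow> ('a \<Rightarrow> 'a) \<Rightarrow> 'a \<Rightarrow> 'a" where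
  "Aut_inv S f \<equiv> restrict (inv_into (univ S) f) (univ S)"

lemma Aut_inverse:
  assumes "f \<in> Aut L S"
  shows "a \<in> univ S \<Longrightarrow> Aut_inv S f (f a) = a" "a \<in> univ S \<Longrightarrow> f (Aut_inv S f a) = a"
  using Aut_inj[OF assms] Aut_image[OF assms] Aut_mem[OF assms] by (auto simp: f_inv_into_f)

lemma Aut_inv:
  assumes "is_structure L S" "f \<in> Aut L S"
  shows "Aut_inv S f \<in> Aut L S"
proof -
  let ?g = "Aut_inv S f"
  have B: "?g \<in> Bij (univ S)" using assms by (intro restrict_inv_into_Bij Aut_Bij)
  have m: "map f (map ?g xs) = xs" "set (map ?g xs) \<subseteq> univ S" if "set xs \<subseteq> univ S" for xs
    using that Aut_inverse(2)[OF assms(2)] Bij_imp_funcset[OF B]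
    by (auto simp del: restrict_apply intro!: map_idI)
  have F: "fint S h xs \<in> univ S" if "(h, length xs) \<in> fsyms L" "set xs \<subseteq> univ S" for h xs
    using that assms(1) unfolding is_structure_def by fastforce
  show ?thesis
    unfolding Aut_def
  proof (intro CollectI conjI ballI B, goal_cases)
    case (1 z)
    then obtain h n where z: "z = (h, n)" by force
    have "?g (fint S h xs) = fint S h (map ?g xs)" if xs: "length xs = n" "set xs \<subseteq> univ S" for xs
    proof -
      have "f (fint S h (map ?g xs)) = fint S h (map f (map ?g xs))"
        using assms(2) m(2)[OF xs(2)] xs(1) 1 z unfolding Aut_def by fastforce
      then have "f (fint S h (map ?g xs)) = fint S h xs" using m(1)[OF xs(2)] by simp
      moreover have "fint S h (map ?g xs) \<in> univ S" using m(2)[OF xs(2)] xs(1) 1 z F by simp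
      ultimately show ?thesis using Aut_inverse(1)[OF assms(2)] by metis
    qed
    then show ?case using z by simp
  next
    case (2 z)
    then obtain h n where z: "z = (h, n)" by force
    have "rint S h xs \<longleftrightarrow> rint S h (map ?g xs)" if xs: "length xs = n" "set xs \<subseteq> univ S" for xs
    proof -
      have "rint S h (map ?g xs) \<longleftrightarrow> rint S h (map f (map ?g xs))"
        using assms(2) m(2)[OF xs(2)] xs(1) 2 z unfolding Aut_def by fastforce
      then show ?thesis using m(1)[OF xs(2)] by simp
    qed
    then show ?case using z by simp
  qed
qed

section \<open>Small sets\<close>

locale monster =
  fixes L :: "('f, 'r) language" and T :: "('f, 'r, nat) fm set"
    and \<kappa> :: "'k rel" and C :: "('f, 'r, 'a) fo_structure"
  assumes complete: "complete_theory L T" and monster: "monster_model L T \<kappa> C"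
begin

lemma card: "Card_order \<kappa>" and small_T: "small \<kappa> T" and limit: "strong_limit \<kappa>"
  and struct: "is_structure L C" and models_T: "models C T" and saturated: "saturated L \<kappa> C"
  and homogeneous: "strongly_homogeneous L \<kappa> C"
  using monster by (auto simp: monster_model_def)

lemma valid_in_T:
  assumes "wf_fm L \<phi>" "fv \<phi> = {}" "\<And>v. sat C v \<phi>"
  shows "\<phi> \<in> T"
proof (rule ccontr)
  assume "\<phi> \<notin> T"
  then have "Neg \<phi> \<in> T"
    using complete assms by (auto simp: complete_theory_def sentences_def)
  moreover obtain a where "a \<in> univ C" using struct by (auto simp: is_structure_def)
  ultimately have "sat C (\<lambda>_. a) (Neg \<phi>)" using models_T by (auto simp: models_def)
  then show False using assms(3) by simp
qed

fun strip_All :: "('f, 'r, 'v) fm \<Rightarrow> ('f, 'r, 'v) fm" where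
  "strip_All (All x \<phi>) = strip_All \<phi>"
| "strip_All \<phi> = \<phi>"

definition tautology :: "('f, 'r, nat) fm \<Rightarrow> ('f, 'r, nat) fm" where
  "tautology \<phi> = foldr All (sorted_list_of_set (fv \<phi>)) (Imp \<phi> \<phi>)"

text \<open>
  Smallness of \<^term>\<open>T\<close> bounds the language: the universal closure of \<open>\<phi> \<longrightarrow> \<phi>\<close> belongs to the
  complete theory \<^term>\<open>T\<close>, and different \<open>\<phi>\<close> give different sentences.
\<close>

lemma formulas_ordLeq_T: "|{\<phi> :: ('f, 'r, nat) fm. wf_fm L \<phi>}| \<le>o |T|"
proof -
  have strip: "strip_All (foldr All xs (Imp \<phi> \<phi>)) = Imp \<phi> \<phi>" for xs and \<phi> :: "('f, 'r, nat) fm"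
    by (induction xs) auto
  have "inj_on tautology {\<phi>. wf_fm L \<phi>}"
  proof (rule inj_onI)
    fix \<phi> \<psi>
    assume "tautology \<phi> = tautology \<psi>"
    then have "strip_All (tautology \<phi>) = strip_All (tautology \<psi>)" by simp
    then show "\<phi> = \<psi>" unfolding tautology_def strip by simp
  qed
  moreover have "tautology \<phi> \<in> T" if "wf_fm L \<phi>" for \<phi>
  proof (rule valid_in_T)
    have "wf_fm L (foldr All xs (Imp \<phi> \<phi>))" "fv (foldr All xs (Imp \<phi> \<phi>)) = fv \<phi> - set xs"
      "sat C v (foldr All xs (Imp \<phi> \<phi>))" for xs v
      using that by (induction xs arbitrary: v) auto
    then show "wf_fm L (tautology \<phi>)" "fv (tautology \<phi>) = {}" "sat C v (tautology \<phi>)" for v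
      by (auto simp: tautology_def)
  qed
  ultimately show ?thesis by (intro card_of_ordLeqI[of tautology]) auto
qed

lemma small_formulas: "small \<kappa> {\<phi> :: ('f, 'r, nat) fm. wf_fm L \<phi>}"
  using ordLeq_ordLess_trans[OF formulas_ordLeq_T] small_T by (auto simp: small_def)

lemma infinite_formulas: "infinite {\<phi> :: ('f, 'r, nat) fm. wf_fm L \<phi>}"
proof -
  let ?g = "\<lambda>n :: nat. Equal (Var n) (Var n) :: ('f, 'r, nat) fm"
  have "inj ?g" by (auto intro: injI)
  moreover have "range ?g \<subseteq> {\<phi>. wf_fm L \<phi>}" by auto
  ultimately show ?thesis using finite_subset range_inj_infinite by blast
qed

lemma infinite_Field: "infinite (Field \<kappa>)"
proof
  assume "finite (Field \<kappa>)"
  moreover have "|{\<phi> :: ('f, 'r, nat) fm. wf_fm L \<phi>}| \<le>o |Field \<kappa>|"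
    using small_formulas card card_of_Field_ordIso ordLess_imp_ordLeq ordLeq_ordIso_trans
      ordIso_symmetric unfolding small_def by metis
  ultimately show False using infinite_formulas card_of_ordLeq_finite by blast
qed

lemma small_ordLeq: "|A| \<le>o |B| \<Longrightarrow> small \<kappa> B \<Longrightarrow> small \<kappa> A"
  using ordLeq_ordLess_trans by (auto simp: small_def)

lemma small_image: "small \<kappa> A \<Longrightarrow> small \<kappa> (f ` A)"
  by (rule small_ordLeq[OF card_of_image])

lemma small_finite: "finite A \<Longrightarrow> small \<kappa> A"
  unfolding small_def using infinite_Field card
  by (intro finite_ordLess_infinite) (auto simp: Field_card_of card_order_on_well_order_on)

lemma small_Un: "small \<kappa> A \<Longrightarrow> small \<kappa> B \<Longrightarrow> small \<kappa> (A \<union> B)"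
  unfolding small_def by (rule card_of_Un_ordLess_infinite_Field[OF infinite_Field card])

lemma small_Times: "small \<kappa> A \<Longrightarrow> small \<kappa> B \<Longrightarrow> small \<kappa> (A \<times> B)"
  unfolding small_def by (rule card_of_Times_ordLess_infinite_Field[OF infinite_Field card])

lemma small_lists:
  assumes "small \<kappa> A"
  shows "small \<kappa> (lists A)"
proof -
  \<comment> \<open>The formulas are added to make the set infinite, so that it has as many lists as elements.\<close>
  let ?B = "A <+> {\<phi> :: ('f, 'r, nat) fm. wf_fm L \<phi>}"
  have "small \<kappa> ?B" unfolding Plus_def
    by (intro small_Un small_image assms small_formulas)
  moreover have "|lists ?B| \<le>o |?B|"
    using card_of_lists_infinite infinite_formulas ordIso_imp_ordLeq finite_Plus_iff by blast
  moreover have "|lists A| \<le>o |lists ?B|"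
    by (rule card_of_lists_mono[OF card_of_Plus1])
  ultimately show ?thesis by (meson small_ordLeq)
qed

text \<open>
  The degree of saturation may be singular, so that a small union of small sets can fail to be
  small.  A uniform bound on the members repairs this, and finiteness is all that is needed.
\<close>

lemma small_UN_finite:
  assumes "small \<kappa> I" "\<And>i. i \<in> I \<Longrightarrow> finite (A i)"
  shows "small \<kappa> (\<Union>i\<in>I. A i)"
proof -
  let ?B = "I <+> {\<phi> :: ('f, 'r, nat) fm. wf_fm L \<phi>}"
  have inf: "infinite ?B" using infinite_formulas by (simp add: finite_Plus_iff)
  have "|A i| \<le>o |?B|" if "i \<in> I" for i
    using finite_ordLess_infinite2[OF assms(2)[OF that] inf] ordLess_imp_ordLeq by blast
  then have "|\<Union>i\<in>I. A i| \<le>o |?B|"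
    by (intro card_of_UNION_ordLeq_infinite[OF inf card_of_Plus1]) auto
  moreover have "small \<kappa> ?B" unfolding Plus_def
    by (intro small_Un small_image assms small_formulas)
  ultimately show ?thesis using small_ordLeq by blast
qed

text \<open>
  Indices from \<^term>\<open>Field \<kappa>\<close> serve two purposes: strong limits are defined through
  subsets of it, and, as elements of an infinite type, the indices can be used as variables.
\<close>

lemma small_index:
  assumes "small \<kappa> A"
  obtains m X where "X \<subseteq> Field \<kappa>" "small \<kappa> X" "bij_betw m X A"
proof -
  have "|A| \<le>o |Field \<kappa>|"
    using assms card card_of_Field_ordIso ordLess_imp_ordLeq ordLeq_ordIso_trans
      ordIso_symmetric unfolding small_def by metis
  then obtain f where f: "inj_on f A" "f ` A \<subseteq> Field \<kappa>" using card_of_ordLeq by metis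
  then have "bij_betw (inv_into A f) (f ` A) A" by (simp add: bij_betw_inv_into inj_on_imp_bij_betw)
  then show thesis using that f small_image[OF assms] by blast
qed

lemma small_Pow:
  assumes "small \<kappa> A"
  shows "small \<kappa> (Pow A)"
proof -
  obtain m X where X: "X \<subseteq> Field \<kappa>" "small \<kappa> X" "bij_betw m X A" using small_index[OF assms] .
  then have "small \<kappa> (Pow X)" using limit by (auto simp: strong_limit_def)
  moreover have "Pow A = (\<lambda>Y. m ` Y) ` Pow X"
    using X(3) by (metis bij_betw_imp_surj_on image_Pow_surj)
  ultimately show ?thesis using small_image by metis
qed

lemma small_enumeration:
  assumes "small \<kappa> A"
  obtains \<mu> t where "small_cardinal \<kappa> \<mu>" "bij_betw t (underS \<kappa> \<mu>) A"
proof -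
  have wo: "Well_order \<kappa>" using card by (simp add: card_order_on_well_order_on)
  obtain \<mu> where \<mu>: "\<mu> \<in> Field \<kappa>" "|A| =o Restr \<kappa> (underS \<kappa> \<mu>)"
    using assms ordLess_iff_ordIso_Restr[OF wo card_of_Well_order] by (auto simp: small_def)
  have "small_cardinal \<kappa> \<mu>"
    using \<mu>(1) Card_order_ordIso2[OF card_of_Card_order \<mu>(2)]
    by (simp add: small_cardinal_def small_ordinal_def)
  have "Field (Restr \<kappa> (underS \<kappa> \<mu>)) = underS \<kappa> \<mu>"
  proof (rule Refl_Field_Restr2)
    show "Refl \<kappa>"
      using wo by (simp add: well_order_on_def linear_order_on_def partial_order_on_def preorder_on_def)
  qed (auto simp: underS_def Field_def)
  moreover obtain s where "BNF_Wellorder_Embedding.iso |A| (Restr \<kappa> (underS \<kappa> \<mu>)) s"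
    using \<mu>(2) unfolding ordIso_def by blast
  ultimately have "bij_betw s A (underS \<kappa> \<mu>)" by (simp only: BNF_Wellorder_Embedding.iso_def Field_card_of)
  then show thesis using that[OF \<open>small_cardinal \<kappa> \<mu>\<close>] bij_betw_inv_into by metis
qed

section \<open>Strong homogeneity and saturation for tuples\<close>

text \<open>
  Two small tuples with the same type are conjugate.  The tuples may list an element several
  times; the formula \<open>x = y\<close> then shows that the map between them is well defined.
\<close>

lemma ex_automorphism:
  fixes u u' :: "'v \<Rightarrow> 'a"
  assumes "small \<kappa> V" "u ` V \<subseteq> univ C" "u' ` V \<subseteq> univ C"
    and type: "\<And>(\<phi> :: ('f, 'r, nat) fm) w. wf_fm L \<phi> \<Longrightarrow> w ` fv \<phi> \<subseteq> V \<Longrightarrow>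
      sat C (\<lambda>n. u (w n)) \<phi> \<Longrightarrow> sat C (\<lambda>n. u' (w n)) \<phi>"
  obtains f where "f \<in> Aut L C" "\<And>x. x \<in> V \<Longrightarrow> f (u x) = u' x"
proof -
  define h where "h a = u' (inv_into V u a)" for a
  have wd: "u' x = u' y" if "x \<in> V" "y \<in> V" "u x = u y" for x y
    using type[of "Equal (Var 0) (Var 1)" "\<lambda>n. if n = 0 then x else y"] that by auto
  have h: "h (u x) = u' x" if "x \<in> V" for x
    unfolding h_def using that by (intro wd) (auto simp: inv_into_into f_inv_into_f)
  have "sat C v \<phi> \<longleftrightarrow> sat C (h \<circ> v) \<phi>" if "wf_fm L \<phi>" "v ` fv \<phi> \<subseteq> u ` V"
    for \<phi> :: "('f, 'r, nat) fm" and v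
  proof -
    let ?w = "\<lambda>n. inv_into V u (v n)"
    have w: "?w ` fv \<phi> \<subseteq> V" using that(2) by (auto intro!: inv_into_into)
    have "sat C v \<phi> \<longleftrightarrow> sat C (\<lambda>n. u (?w n)) \<phi>"
      by (rule sat_cong) (use that(2) in \<open>auto simp: f_inv_into_f\<close>)
    moreover have "sat C (h \<circ> v) \<phi> \<longleftrightarrow> sat C (\<lambda>n. u' (?w n)) \<phi>"
      by (rule sat_cong) (simp add: h_def)
    moreover have "sat C (\<lambda>n. u (?w n)) \<phi> \<longleftrightarrow> sat C (\<lambda>n. u' (?w n)) \<phi>"
      using type[of \<phi> ?w] type[of "Neg \<phi>" ?w] that(1) w by auto
    ultimately show ?thesis by blast
  qed
  then have "elementary_map L C (u ` V) h"
    unfolding elementary_map_def using assms(2,3) h by auto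
  then obtain f where "f \<in> Aut L C" "\<forall>a\<in>u ` V. f a = h a"
    using homogeneous small_image[OF assms(1)] unfolding strongly_homogeneous_def by blast
  then show thesis using that h by auto
qed

text \<open>
  Saturation is assumed for types in one variable.  For a small tuple of variables one assigns
  values to the variables one after the other, that is, one adds equations \<open>x\<^sub>i = a\<close> to the type as
  long as it remains finitely satisfiable.  A maximal set of equations gives a value to each
  \<open>x\<^sub>i\<close>: the formulas that existentially quantify all other variables of a finite part of
  the type form a type in the single variable \<open>x\<^sub>i\<close>.
\<close>

lemma ex_realization:
  fixes p :: "('f, 'r, 'i + 'a) fm set"
  assumes X: "small \<kappa> X" and A: "A \<subseteq> univ C" "small \<kappa> A" and p: "partial_type_over L C X A p"
  shows "solutions C X p \<noteq> {}"
proof -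
  define eqs where
    "eqs G = (\<lambda>(i, a). Equal (Var (Inl i)) (Var (Inr a)) :: ('f, 'r, 'i + 'a) fm) ` G" for G
  define fs where "fs q \<longleftrightarrow> (\<forall>q0. finite q0 \<and> q0 \<subseteq> q \<longrightarrow> solutions C X q0 \<noteq> {})" for q
  define \<G> where "\<G> = {G. G \<subseteq> X \<times> univ C \<and> fs (p \<union> eqs G)}"
  have mono: "solutions C X q' \<subseteq> solutions C X q" if "q \<subseteq> q'" for q q'
    using that by (auto simp: solutions_def)
  have "{} \<in> \<G>" using p by (auto simp: \<G>_def fs_def eqs_def partial_type_over_def)
  have chain: "\<Union>\<C> \<in> \<G>" if "\<C> \<noteq> {}" "subset.chain \<G> \<C>" for \<C>
  proof -
    have "\<C> \<subseteq> \<G>" using that(2) by (simp add: subset.chain_def)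
    have "solutions C X q \<noteq> {}" if q: "finite q" "q \<subseteq> p \<union> eqs (\<Union>\<C>)" for q
    proof -
      have "q - p \<subseteq> eqs (\<Union>\<C>)" using q(2) by blast
      then have "\<exists>G0\<subseteq>\<Union>\<C>. finite G0 \<and> q - p = eqs G0"
        using q(1) unfolding eqs_def by (intro finite_subset_image) auto
      then obtain G0 where G0: "G0 \<subseteq> \<Union>\<C>" "finite G0" "q - p = eqs G0" by blast
      then obtain G where G: "G \<in> \<C>" "G0 \<subseteq> G"
        using finite_subset_Union_chain \<open>\<C> \<noteq> {}\<close> \<open>subset.chain \<G> \<C>\<close> by metis
      then have "eqs G0 \<subseteq> eqs G" unfolding eqs_def by (intro image_mono)
      then have "q \<subseteq> p \<union> eqs G" using G0(3) by blast
      then show ?thesis using G(1) \<open>\<C> \<subseteq> \<G>\<close> q(1) by (auto simp: \<G>_def fs_def)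
    qed
    then show ?thesis using \<open>\<C> \<subseteq> \<G>\<close> by (auto simp: \<G>_def fs_def)
  qed
  obtain G where G: "G \<in> \<G>" and max: "\<And>H. H \<in> \<G> \<Longrightarrow> G \<subseteq> H \<Longrightarrow> H = G"
    using subset_Zorn_nonempty[of \<G>] chain \<open>{} \<in> \<G>\<close> by blast
  have GX: "G \<subseteq> X \<times> univ C" and Gfs: "fs (p \<union> eqs G)" using G by (auto simp: \<G>_def)
  have functional: "a = a'" if "(i, a) \<in> G" "(i, a') \<in> G" for i a a'
  proof -
    have "finite (eqs {(i, a), (i, a')})" "eqs {(i, a), (i, a')} \<subseteq> p \<union> eqs G"
      using that by (auto simp: eqs_def)
    then have "solutions C X (eqs {(i, a), (i, a')}) \<noteq> {}" using Gfs unfolding fs_def by blast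
    then show ?thesis by (auto simp: solutions_def eqs_def)
  qed
  let ?A = "A \<union> snd ` G"
  have "inj_on fst G" using functional by (force intro: inj_onI)
  then have "|G| \<le>o |X|" using GX by (intro card_of_ordLeqI[of fst]) auto
  then have smallA: "small \<kappa> ?A" using A X by (intro small_Un small_image small_ordLeq[of G X])
  have fvG: "wf_fm L \<phi> \<and> fv \<phi> \<subseteq> Inl ` X \<union> Inr ` ?A" if "\<phi> \<in> p \<union> eqs G" for \<phi>
  proof (cases "\<phi> \<in> p")
    case True
    then show ?thesis using p unfolding partial_type_over_def by blast
  next
    case False
    then obtain i a where "(i, a) \<in> G" "\<phi> = Equal (Var (Inl i)) (Var (Inr a))"
      using \<open>\<phi> \<in> p \<union> eqs G\<close> by (auto simp: eqs_def)
    then show ?thesis using GX by force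
  qed
  have total: "\<exists>a. (i, a) \<in> G" if i: "i \<in> X" for i
  proof -
    \<comment> \<open>\<open>proj q \<psi>\<close>: the formula \<open>\<psi>\<close> in one variable says that some solution of \<open>q\<close> has that value at \<open>i\<close>.\<close>
    define proj where "proj q \<psi> \<longleftrightarrow> wf_fm L \<psi> \<and> fv \<psi> \<subseteq> Inl ` {0} \<union> Inr ` ?A \<and>
      (\<forall>c. c 0 \<in> univ C \<longrightarrow> (sat C (case_sum c id) \<psi> \<longleftrightarrow> (\<exists>b\<in>solutions C X q. b i = c 0)))"
      for q and \<psi> :: "('f, 'r, nat + 'a) fm"
    have "\<exists>\<psi>. proj q \<psi>" if q: "finite q" "q \<subseteq> p \<union> eqs G" for q
    proof -
      obtain \<chi> :: "('f, 'r, 'i + 'a) fm" where \<chi>: "wf_fm L \<chi>" "fv \<chi> = (\<Union>\<phi>\<in>q. fv \<phi>)"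
        "\<And>v. sat C v \<chi> \<longleftrightarrow> (\<forall>\<phi>\<in>q. sat C v \<phi>)"
        using ex_conjunction[OF q(1), of L C] q(2) fvG by blast
      have fv\<chi>: "fv \<chi> \<subseteq> Inl ` X \<union> Inr ` ?A" using fvG q(2) unfolding \<chi>(2) by blast
      define Y where "Y = {x \<in> fv \<chi>. \<exists>j. x = Inl j \<and> j \<noteq> i}"
      have Y: "finite Y" "Y \<subseteq> Inl ` X" using fv\<chi> by (auto simp: Y_def)
      obtain \<chi>' :: "('f, 'r, 'i + 'a) fm" where \<chi>': "wf_fm L \<chi>'" "fv \<chi>' = fv \<chi> - Y"
        "\<And>v. sat C v \<chi>' \<longleftrightarrow>
          (\<exists>w. (\<forall>x\<in>Y. w x \<in> univ C) \<and> (\<forall>x. x \<notin> Y \<longrightarrow> w x = v x) \<and> sat C w \<chi>)"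
        using ex_projection[OF Y(1) \<chi>(1), of C] by blast
      define w where "w = case_sum (\<lambda>_ :: 'i. Inl (0 :: nat)) (Inr :: 'a \<Rightarrow> nat + 'a)"
      obtain \<psi> :: "('f, 'r, nat + 'a) fm" where \<psi>: "wf_fm L \<psi>" "fv \<psi> = w ` fv \<chi>'"
        "\<And>u. sat C u \<psi> \<longleftrightarrow> sat C (\<lambda>x. u (w x)) \<chi>'"
        using ex_substitution[OF _ \<chi>'(1), of w C] by auto
      have "fv \<psi> \<subseteq> Inl ` {0} \<union> Inr ` ?A"
      proof
        fix y assume "y \<in> fv \<psi>"
        then obtain x where "x \<in> fv \<chi>" "y = w x" unfolding \<psi>(2) \<chi>'(2) by blast
        then show "y \<in> Inl ` {0} \<union> Inr ` ?A" using fv\<chi> by (cases x) (auto simp: w_def)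
      qed
      moreover have "sat C (case_sum c id) \<psi> \<longleftrightarrow> (\<exists>b\<in>solutions C X q. b i = c 0)" (is "?l \<longleftrightarrow> ?r")
        if c: "c 0 \<in> univ C" for c
      proof
        assume ?l
        then obtain z where z: "\<And>x. x \<in> Y \<Longrightarrow> z x \<in> univ C"
          "\<And>x. x \<notin> Y \<Longrightarrow> z x = case_sum c id (w x)" "sat C z \<chi>"
          unfolding \<psi>(3) \<chi>'(3) by blast
        define b where "b = (\<lambda>j\<in>X. if Inl j \<in> Y then z (Inl j) else c 0)"
        have "sat C (case_sum b id) \<chi> \<longleftrightarrow> sat C z \<chi>"
        proof (rule sat_cong)
          fix x assume "x \<in> fv \<chi>"
          then show "case_sum b id x = z x"
            using fv\<chi> z(2)[of x] i by (cases x) (auto simp: b_def w_def Y_def)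
        qed
        then have "b \<in> solutions C X q"
          using z c \<chi>(3) by (auto simp: solutions_def b_def)
        moreover have "b i = c 0" using i by (simp add: b_def Y_def)
        ultimately show ?r by blast
      next
        assume ?r
        then obtain b where b: "b \<in> solutions C X q" "b i = c 0" by blast
        define z where "z x = (if x \<in> Y then case_sum b id x else case_sum c id (w x))" for x
        have "sat C z \<chi> \<longleftrightarrow> sat C (case_sum b id) \<chi>"
        proof (rule sat_cong)
          fix x assume "x \<in> fv \<chi>"
          then show "z x = case_sum b id x"
            using b(2) by (cases x) (auto simp: z_def w_def Y_def)
        qed
        then have "sat C z \<chi>" using b(1) \<chi>(3) by (auto simp: solutions_def)
        moreover have "z x \<in> univ C" if "x \<in> Y" for x
          using that Y(2) b(1) by (force simp: z_def solutions_def)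
        ultimately show ?l unfolding \<psi>(3) \<chi>'(3)
          by (intro exI[of _ z]) (auto simp: z_def)
      qed
      ultimately show ?thesis using \<psi>(1) unfolding proj_def by blast
    qed
    then obtain \<Psi> where \<Psi>: "\<And>q. finite q \<Longrightarrow> q \<subseteq> p \<union> eqs G \<Longrightarrow> proj q (\<Psi> q)" by metis
    let ?Q = "{q. finite q \<and> q \<subseteq> p \<union> eqs G}"
    have "partial_type_over L C {0} ?A (\<Psi> ` ?Q)"
      unfolding partial_type_over_def
    proof (rule conjI; intro allI impI ballI)
      fix \<psi> assume "\<psi> \<in> \<Psi> ` ?Q"
      then show "wf_fm L \<psi> \<and> fv \<psi> \<subseteq> Inl ` {0} \<union> Inr ` ?A" using \<Psi> by (auto simp: proj_def)
    next
      fix r assume "r \<subseteq> \<Psi> ` ?Q \<and> finite r"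
      then obtain R where R: "R \<subseteq> ?Q" "finite R" "r = \<Psi> ` R"
        using finite_subset_image[of r \<Psi> ?Q] by blast
      then have "finite (\<Union>R)" "\<Union>R \<subseteq> p \<union> eqs G" by auto
      then obtain b where b: "b \<in> solutions C X (\<Union>R)" using Gfs unfolding fs_def by blast
      define c where "c = (\<lambda>_\<in>{0 :: nat}. b i)"
      have c: "c 0 \<in> univ C" using b i by (auto simp: c_def solutions_def)
      have "sat C (case_sum c id) (\<Psi> q)" if "q \<in> R" for q
      proof -
        have "proj q (\<Psi> q)" using \<Psi> R(1) that by blast
        moreover have "b \<in> solutions C X q" using mono[of q "\<Union>R"] b that by blast
        moreover have "b i = c 0" by (simp add: c_def)
        ultimately show ?thesis using c unfolding proj_def by blast
      qed
      then have "c \<in> solutions C {0} r" using R(3) c by (auto simp: solutions_def c_def)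
      then show "solutions C {0} r \<noteq> {}" by blast
    qed
    moreover have "?A \<subseteq> univ C" using A GX by auto
    ultimately obtain c where c: "c \<in> solutions C {0} (\<Psi> ` ?Q)"
      using saturated smallA unfolding saturated_def by blast
    then have c0: "c 0 \<in> univ C" by (auto simp: solutions_def)
    have "solutions C X q \<noteq> {}" if q: "finite q" "q \<subseteq> p \<union> eqs (insert (i, c 0) G)" for q
    proof -
      let ?q = "q - eqs {(i, c 0)}"
      have q': "finite ?q" "?q \<subseteq> p \<union> eqs G" using q by (auto simp: eqs_def)
      then have "sat C (case_sum c id) (\<Psi> ?q)" using c by (auto simp: solutions_def)
      then obtain b where "b \<in> solutions C X ?q" "b i = c 0"
        using \<Psi>[OF q'] c0 unfolding proj_def by blast
      then have "b \<in> solutions C X q" by (auto simp: solutions_def eqs_def)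
      then show ?thesis by blast
    qed
    then have "insert (i, c 0) G \<in> \<G>" using GX i c0 by (auto simp: \<G>_def fs_def)
    then show ?thesis using max[of "insert (i, c 0) G"] by blast
  qed
  then obtain a where a: "\<And>i. i \<in> X \<Longrightarrow> (i, a i) \<in> G" by metis
  let ?b = "restrict a X"
  have "sat C (case_sum ?b id) \<phi>" if \<phi>: "\<phi> \<in> p" for \<phi>
  proof -
    let ?I = "{i. Inl i \<in> fv \<phi>}"
    have I: "?I \<subseteq> X" "finite ?I"
      using p \<phi> finite_vimageI[OF finite_fv, of Inl \<phi>]
      by (auto simp: partial_type_over_def vimage_def)
    let ?q = "insert \<phi> (eqs ((\<lambda>i. (i, a i)) ` ?I))"
    have "eqs ((\<lambda>i. (i, a i)) ` ?I) \<subseteq> eqs G"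
      unfolding eqs_def by (intro image_mono) (use a I in auto)
    then have "finite ?q" "?q \<subseteq> p \<union> eqs G" using I(2) \<phi> by (auto simp: eqs_def)
    then obtain b where b: "b \<in> solutions C X ?q" using Gfs by (force simp: fs_def)
    have "sat C (case_sum ?b id) \<phi> \<longleftrightarrow> sat C (case_sum b id) \<phi>"
    proof (rule sat_cong)
      fix x assume "x \<in> fv \<phi>"
      then show "case_sum ?b id x = case_sum b id x"
        using b I(1) by (cases x) (auto simp: solutions_def eqs_def)
    qed
    then show ?thesis using b by (auto simp: solutions_def)
  qed
  then have "?b \<in> solutions C X p" using a GX by (auto simp: solutions_def)
  then show ?thesis by blast
qed

end

section \<open>Small elementary submodels\<close>

context monster
begin

text \<open>
  The Tarski-Vaught criterion.  It speaks of satisfaction in \<^term>\<open>C\<close> alone, so it is what a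
  closure process yields and what automorphisms visibly preserve.
\<close>

definition tarski_vaught :: "'a set \<Rightarrow> bool" where
  "tarski_vaught M \<longleftrightarrow> M \<subseteq> univ C \<and> M \<noteq> {} \<and>
     (\<forall>(\<phi> :: ('f, 'r, nat) fm) v x a. wf_fm L \<phi> \<and> range v \<subseteq> M \<and> a \<in> univ C \<and>
        sat C (v(x := a)) \<phi> \<longrightarrow> (\<exists>b\<in>M. sat C (v(x := b)) \<phi>))"

lemma tarski_vaughtD:
  fixes \<phi> :: "('f, 'r, nat) fm"
  assumes "tarski_vaught M" "wf_fm L \<phi>" "range v \<subseteq> M" "a \<in> univ C" "sat C (v(x := a)) \<phi>"
  shows "\<exists>b\<in>M. sat C (v(x := b)) \<phi>"
  using assms unfolding tarski_vaught_def by blast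

lemma elem_submodel_if_tarski_vaught:
  assumes M: "tarski_vaught M"
  shows "elem_submodel L C M"
proof -
  have MC: "M \<subseteq> univ C" using M by (simp add: tarski_vaught_def)
  obtain m where m: "m \<in> M" using M by (auto simp: tarski_vaught_def)
  have "fint C g xs \<in> M" if g: "(g, n) \<in> fsyms L" and xs: "length xs = n" "set xs \<subseteq> M" for g n xs
  proof -
    \<comment> \<open>The value is the witness for \<open>\<exists>x\<^sub>n. x\<^sub>n = g(x\<^sub>0, \<dots>, x\<^sub>n\<^sub>-\<^sub>1)\<close>.\<close>
    let ?\<phi> = "Equal (Var n) (App g (map Var [0..<n])) :: ('f, 'r, nat) fm"
    let ?v = "\<lambda>k. if k < n then xs ! k else m"
    have "map (val C (?v(n := b)) \<circ> Var) [0..<n] = xs" for b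
      using xs(1) by (intro nth_equalityI) auto
    then have sat: "sat C (?v(n := b)) ?\<phi> \<longleftrightarrow> b = fint C g xs" for b by simp
    have "fint C g xs \<in> univ C" using struct g xs MC unfolding is_structure_def by fastforce
    moreover have "range ?v \<subseteq> M" using xs m by auto
    ultimately show ?thesis
      using tarski_vaughtD[OF M, of ?\<phi> ?v "fint C g xs" n] g unfolding sat by auto
  qed
  then have "is_structure L (C\<lparr>univ := M\<rparr>)" using m by (auto simp: is_structure_def)
  moreover have val: "val (C\<lparr>univ := M\<rparr>) v t = val C v t" for v :: "nat \<Rightarrow> 'a" and t
    by (induction t) (simp_all cong: map_cong)
  have "sat (C\<lparr>univ := M\<rparr>) v \<phi> \<longleftrightarrow> sat C v \<phi>" if "wf_fm L \<phi>" "range v \<subseteq> M"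
    for \<phi> :: "('f, 'r, nat) fm" and v
    using that
  proof (induction \<phi> arbitrary: v)
    case (All x \<phi>)
    have "sat (C\<lparr>univ := M\<rparr>) v (All x \<phi>) \<longleftrightarrow> (\<forall>a\<in>M. sat C (v(x := a)) \<phi>)"
      using All by (simp add: image_subset_iff)
    also have "\<dots> \<longleftrightarrow> sat C v (All x \<phi>)"
      using tarski_vaughtD[OF M, of "Neg \<phi>" v _ x] All.prems MC by auto
    finally show ?case .
  qed (simp_all add: val[abs_def] comp_def cong: map_cong)
  ultimately show ?thesis using MC by (auto simp: elem_submodel_def image_subset_iff)
qed

lemma tarski_vaught_image:
  assumes M: "tarski_vaught M" and f: "f \<in> Aut L C"
  shows "tarski_vaught (f ` M)"
  unfolding tarski_vaught_def
proof (intro conjI allI impI; (elim conjE)?)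
  have MC: "M \<subseteq> univ C" "M \<noteq> {}" using M by (auto simp: tarski_vaught_def)
  then show "f ` M \<subseteq> univ C" "f ` M \<noteq> {}" using Aut_mem[OF f] by auto
  fix \<phi> :: "('f, 'r, nat) fm" and v x a
  assume \<phi>: "wf_fm L \<phi>" and v: "range v \<subseteq> f ` M" and a: "a \<in> univ C" "sat C (v(x := a)) \<phi>"
  have "\<forall>n. \<exists>b\<in>M. v n = f b" using v by blast
  then obtain u where u: "\<And>n. u n \<in> M" "\<And>n. v n = f (u n)" by metis
  obtain a' where a': "a' \<in> univ C" "a = f a'" using a(1) Aut_image[OF f] by blast
  have eq: "sat C (v(x := f b)) \<phi> \<longleftrightarrow> sat C (u(x := b)) \<phi>" if "b \<in> univ C" for b
  proof -
    have "v(x := f b) = (\<lambda>y. f ((u(x := b)) y))" using u(2) by auto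
    moreover have "(u(x := b)) ` fv \<phi> \<subseteq> univ C" using u(1) MC that by auto
    ultimately show ?thesis using sat_Aut[OF struct f \<phi>] by metis
  qed
  obtain b where "b \<in> M" "sat C (u(x := b)) \<phi>"
    using tarski_vaughtD[OF M \<phi>, of u a' x] u(1) a a' eq by auto
  then show "\<exists>b\<in>f ` M. sat C (v(x := b)) \<phi>" using eq MC by blast
qed

text \<open>
  Downward Loewenheim-Skolem: closing a small set under witness functions takes countably many
  rounds, each of which adds at most as many elements as there are pairs of a formula and a
  finite list of elements that are already present.
\<close>

lemma ex_tarski_vaught:
  assumes A: "A \<subseteq> univ C" "small \<kappa> A"
  obtains M where "A \<subseteq> M" "small \<kappa> M" "tarski_vaught M"
proof -
  let ?F = "{\<phi> :: ('f, 'r, nat) fm. wf_fm L \<phi>}"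
  obtain a0 where a0: "a0 \<in> univ C" using struct by (auto simp: is_structure_def)
  define W where "W = (\<lambda>(\<phi> :: ('f, 'r, nat) fm, x, xs). SOME a. a \<in> univ C \<and>
    ((\<exists>b\<in>univ C. sat C ((\<lambda>n. xs ! n)(x := b)) \<phi>) \<longrightarrow> sat C ((\<lambda>n. xs ! n)(x := a)) \<phi>))"
  have W: "W (\<phi>, x, xs) \<in> univ C \<and> ((\<exists>b\<in>univ C. sat C ((\<lambda>n. xs ! n)(x := b)) \<phi>) \<longrightarrow>
      sat C ((\<lambda>n. xs ! n)(x := W (\<phi>, x, xs))) \<phi>)" for \<phi> x xs
    unfolding W_def prod.case by (rule someI_ex) (use a0 in blast)
  define N where "N = rec_nat (insert a0 A) (\<lambda>_ B. B \<union> W ` (?F \<times> UNIV \<times> lists B))"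
  have N0: "N 0 = insert a0 A" and NS: "N (Suc n) = N n \<union> W ` (?F \<times> UNIV \<times> lists (N n))" for n
    by (simp_all add: N_def)
  have mono: "N n \<subseteq> N k" if "n \<le> k" for n k
    using that by (rule lift_Suc_mono_le[rotated]) (simp add: NS)
  let ?M = "\<Union>n. N n"
  let ?B = "insert a0 A <+> ?F"
  have inf: "infinite ?B" using infinite_formulas by (simp add: finite_Plus_iff)
  have leB: "|X \<times> Y| \<le>o |?B|" if "|X| \<le>o |?B|" "|Y| \<le>o |?B|" for X :: "'x set" and Y :: "'y set"
    using that inf by (intro card_of_Times_ordLeq_infinite)
  have natB: "|UNIV :: nat set| \<le>o |?B|" using inf infinite_iff_card_of_nat by blast
  have "|N n| \<le>o |?B|" for n
  proof (induction n)
    case 0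
    show ?case unfolding N0 by (rule card_of_Plus1)
  next
    case (Suc n)
    have "|lists (N n)| \<le>o |?B|"
      using card_of_lists_mono[OF Suc] card_of_lists_infinite[OF inf] ordLeq_ordIso_trans by blast
    then have "|?F \<times> (UNIV :: nat set) \<times> lists (N n)| \<le>o |?B|"
      by (intro leB card_of_Plus2 natB)
    then have "|W ` (?F \<times> UNIV \<times> lists (N n))| \<le>o |?B|"
      using card_of_image ordLeq_transitive by blast
    then show ?case unfolding NS using Suc inf by (intro card_of_Un_ordLeq_infinite)
  qed
  then have "|?M| \<le>o |?B|" using natB by (intro card_of_UNION_ordLeq_infinite[OF inf]) auto
  moreover have "small \<kappa> ?B" unfolding Plus_def
    using small_Un[OF small_finite[of "{a0}"] A(2)]
    by (intro small_Un small_image small_formulas) simp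
  ultimately have small: "small \<kappa> ?M" by (meson small_ordLeq)
  have sub: "N n \<subseteq> univ C" for n
    by (induction n) (use A(1) a0 W in \<open>auto simp: N0 NS\<close>)
  have witness: "\<exists>b\<in>?M. sat C (v(x := b)) \<phi>"
    if \<phi>: "wf_fm L \<phi>" and v: "range v \<subseteq> ?M" and a: "a \<in> univ C" "sat C (v(x := a)) \<phi>"
    for \<phi> :: "('f, 'r, nat) fm" and v x a
  proof -
    obtain l where l: "fv \<phi> \<subseteq> {..<l}" using finite_nat_iff_bounded finite_fv by blast
    let ?xs = "map v [0..<l]"
    have "\<exists>k. v n \<in> N k" for n using v by blast
    then obtain k where k: "\<And>n. v n \<in> N (k n)" by metis
    have "v n \<in> N (Max (k ` {..<l}))" if "n < l" for n
      using k[of n] mono[of "k n" "Max (k ` {..<l})"] that by auto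
    then have "?xs \<in> lists (N (Max (k ` {..<l})))" by auto
    then have "W (\<phi>, x, ?xs) \<in> N (Suc (Max (k ` {..<l})))" unfolding NS using \<phi> by blast
    moreover have "sat C ((\<lambda>n. ?xs ! n)(x := b)) \<phi> \<longleftrightarrow> sat C (v(x := b)) \<phi>" for b
      by (rule sat_cong) (use l in auto)
    ultimately show ?thesis using W[of \<phi> x ?xs] a by blast
  qed
  have "tarski_vaught ?M"
    unfolding tarski_vaught_def
  proof (intro conjI allI impI; (elim conjE)?)
    show "?M \<subseteq> univ C" using sub by blast
    have "a0 \<in> ?M" using N0 by (intro UN_I[of 0]) auto
    then show "?M \<noteq> {}" by blast
  qed (rule witness)
  moreover have "A \<subseteq> ?M" using N0 by (intro subset_trans[OF _ UN_upper[of 0]]) auto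
  ultimately show thesis using that small by blast
qed

end

section \<open>Automorphisms that fix a hyperimaginary\<close>

lemma Aut_id: "is_structure L S \<Longrightarrow> (\<lambda>x\<in>univ S. x) \<in> Aut L S"
proof -
  assume S: "is_structure L S"
  have "map (\<lambda>x\<in>univ S. x) xs = xs" if "set xs \<subseteq> univ S" for xs
    by (rule map_idI) (use that in auto)
  moreover have "fint S g xs \<in> univ S" if "(g, length xs) \<in> fsyms L" "set xs \<subseteq> univ S" for g xs
    using S that unfolding is_structure_def by fastforce
  ultimately show ?thesis by (auto simp: Aut_def id_Bij simp del: restrict_apply) (simp add: restrict_apply)
qed

locale monster_over_hyperimaginary = monster L T \<kappa> C
  for L :: "('f, 'r) language" and T and \<kappa> :: "'k rel" and C :: "('f, 'r, 'a) fo_structure" +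
  fixes \<alpha> :: 'k and e :: "('k \<Rightarrow> 'a) set"
  assumes hyperimaginary: "hyperimaginary L C \<kappa> \<alpha> e"
begin

abbreviation Aut\<^sub>e where "Aut\<^sub>e \<equiv> Aut_over L C \<kappa> \<alpha> e"
abbreviation Autf where "Autf \<equiv> AutfL L C \<kappa> \<alpha> e"

lemma e_tuples: "e \<subseteq> tuples \<kappa> \<alpha> (univ C)" and e_nonempty: "e \<noteq> {}"
proof -
  obtain E a where E: "type_definable_equiv L C \<kappa> \<alpha> E" "a \<in> tuples \<kappa> \<alpha> (univ C)" "e = E `` {a}"
    using hyperimaginary unfolding hyperimaginary_def by blast
  then have eq: "equiv (tuples \<kappa> \<alpha> (univ C)) E" by (simp add: type_definable_equiv_def)
  show "e \<subseteq> tuples \<kappa> \<alpha> (univ C)" using eq unfolding E(3) equiv_def by blast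
  show "e \<noteq> {}" using equiv_class_self[OF eq E(2)] unfolding E(3) by blast
qed

lemma e_univ: "c \<in> e \<Longrightarrow> i \<in> underS \<kappa> \<alpha> \<Longrightarrow> c i \<in> univ C"
  using subsetD[OF e_tuples] PiE_mem by fast

lemma app_eqI:
  assumes "c \<in> e" "\<And>i. i \<in> underS \<kappa> \<alpha> \<Longrightarrow> f (d i) = c i"
  shows "app \<kappa> \<alpha> f d = c"
proof (rule extensionalityI)
  show "c \<in> extensional (underS \<kappa> \<alpha>)" using subsetD[OF e_tuples assms(1)] by (simp add: PiE_iff)
qed (simp_all add: compose_eq assms(2))

lemma Aut\<^sub>e_Aut: "f \<in> Aut\<^sub>e \<Longrightarrow> f \<in> Aut L C"
  and Aut\<^sub>e_e: "f \<in> Aut\<^sub>e \<Longrightarrow> app \<kappa> \<alpha> f ` e = e"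
  by (simp_all add: Aut_over_def)

text \<open>
  The equivalence relation behind \<^term>\<open>e\<close> is defined by formulas without parameters, so
  automorphisms permute its classes, and two classes that meet are equal.
\<close>

lemma Aut\<^sub>eI:
  assumes f: "f \<in> Aut L C" and c: "c \<in> e" "app \<kappa> \<alpha> f c \<in> e"
  shows "f \<in> Aut\<^sub>e"
proof -
  obtain E a where E: "type_definable_equiv L C \<kappa> \<alpha> E" "e = E `` {a}"
    using hyperimaginary unfolding hyperimaginary_def by blast
  then have eq: "equiv (tuples \<kappa> \<alpha> (univ C)) E" by (simp add: type_definable_equiv_def)
  obtain \<Theta> :: "('f, 'r, 'k + 'k) fm set" where \<Theta>:
    "\<And>\<theta>. \<theta> \<in> \<Theta> \<Longrightarrow> wf_fm L \<theta> \<and> fv \<theta> \<subseteq> Inl ` underS \<kappa> \<alpha> \<union> Inr ` underS \<kappa> \<alpha>"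
    "E = type_defined_rel C \<kappa> \<alpha> \<Theta>" using E(1) unfolding type_definable_equiv_def by blast
  have class_eq: "e = E `` {d}" if "d \<in> e" for d
    using equiv_class_eq[OF eq] E(2) that by blast
  have inv: "(app \<kappa> \<alpha> g x, app \<kappa> \<alpha> g y) \<in> E" if "(x, y) \<in> E" "g \<in> Aut L C" for g x y
  proof -
    have xy: "x \<in> tuples \<kappa> \<alpha> (univ C)" "y \<in> tuples \<kappa> \<alpha> (univ C)"
      "\<And>\<theta>. \<theta> \<in> \<Theta> \<Longrightarrow> sat C (case_sum x y) \<theta>"
      using that(1) unfolding \<Theta>(2) type_defined_rel_def by auto
    have "sat C (case_sum (app \<kappa> \<alpha> g x) (app \<kappa> \<alpha> g y)) \<theta>" if \<theta>: "\<theta> \<in> \<Theta>" for \<theta>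
    proof -
      have "case_sum x y ` fv \<theta> \<subseteq> univ C" using \<Theta>(1)[OF \<theta>] xy(1,2) by fastforce
      then have "sat C (\<lambda>z. g (case_sum x y z)) \<theta>"
        using sat_Aut[OF struct \<open>g \<in> Aut L C\<close>] \<Theta>(1)[OF \<theta>] xy(3)[OF \<theta>] by blast
      moreover have "sat C (case_sum (app \<kappa> \<alpha> g x) (app \<kappa> \<alpha> g y)) \<theta> \<longleftrightarrow>
          sat C (\<lambda>z. g (case_sum x y z)) \<theta>"
        by (rule sat_cong) (use \<Theta>(1)[OF \<theta>] in \<open>auto simp: compose_def\<close>)
      ultimately show ?thesis by blast
    qed
    moreover have "app \<kappa> \<alpha> g x \<in> tuples \<kappa> \<alpha> (univ C)" "app \<kappa> \<alpha> g y \<in> tuples \<kappa> \<alpha> (univ C)"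
      using xy(1,2) Aut_mem[OF that(2)] by (auto simp: compose_def)
    ultimately show ?thesis unfolding \<Theta>(2) type_defined_rel_def by auto
  qed
  have "app \<kappa> \<alpha> f y \<in> e" if "y \<in> e" for y
    using inv[OF _ f, of c y] class_eq[OF c(1)] class_eq[OF c(2)] that by blast
  moreover have "y \<in> app \<kappa> \<alpha> f ` e" if "y \<in> e" for y
  proof -
    let ?g = "Aut_inv C f"
    have inverse: "app \<kappa> \<alpha> ?g (app \<kappa> \<alpha> f x) = x" "app \<kappa> \<alpha> f (app \<kappa> \<alpha> ?g x) = x"
      if "x \<in> e" for x
      by (intro app_eqI that; simp add: compose_eq Aut_inverse[OF f] e_univ[OF that] del: restrict_apply)+
    have "(app \<kappa> \<alpha> ?g (app \<kappa> \<alpha> f c), app \<kappa> \<alpha> ?g y) \<in> E"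
      using inv[OF _ Aut_inv[OF struct f]] class_eq[OF c(2)] that by blast
    then have "app \<kappa> \<alpha> ?g y \<in> e" using inverse(1)[OF c(1)] class_eq[OF c(1)] by auto
    then show ?thesis using inverse(2)[OF that] by (metis imageI)
  qed
  ultimately show ?thesis using f by (auto simp: Aut_over_def)
qed

lemma app_compose:
  assumes "c \<in> e" "f \<in> Aut L C" "g \<in> Aut L C"
  shows "app \<kappa> \<alpha> (compose (univ C) f g) c = app \<kappa> \<alpha> f (app \<kappa> \<alpha> g c)"
  using assms e_tuples by (auto simp: compose_def PiE_iff fun_eq_iff restrict_def)

lemma Aut\<^sub>e_compose: "f \<in> Aut\<^sub>e \<Longrightarrow> g \<in> Aut\<^sub>e \<Longrightarrow> compose (univ C) f g \<in> Aut\<^sub>e"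
proof -
  assume fg: "f \<in> Aut\<^sub>e" "g \<in> Aut\<^sub>e"
  obtain c where c: "c \<in> e" using e_nonempty by blast
  then have "app \<kappa> \<alpha> f (app \<kappa> \<alpha> g c) \<in> e" using fg[THEN Aut\<^sub>e_e] by blast
  then show ?thesis
    using c fg by (intro Aut\<^sub>eI[of _ c]) (auto simp: app_compose Aut\<^sub>e_Aut Aut_compose[OF struct])
qed

lemma Aut\<^sub>e_inv: "f \<in> Aut\<^sub>e \<Longrightarrow> Aut_inv C f \<in> Aut\<^sub>e"
proof -
  assume f: "f \<in> Aut\<^sub>e"
  obtain c where c: "c \<in> e" using e_nonempty by blast
  have "app \<kappa> \<alpha> (Aut_inv C f) (app \<kappa> \<alpha> f c) = c"
    by (intro app_eqI c)
      (simp add: compose_eq Aut_inverse(1)[OF Aut\<^sub>e_Aut[OF f]] e_univ[OF c] del: restrict_apply)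
  then show ?thesis
    using c Aut\<^sub>e_e[OF f] Aut_inv[OF struct Aut\<^sub>e_Aut[OF f]]
    by (intro Aut\<^sub>eI[of _ "app \<kappa> \<alpha> f c"]) auto
qed

section \<open>Lascar strong automorphisms form a group\<close>

lemma Autf_subset: "f \<in> Autf \<Longrightarrow> f \<in> Aut\<^sub>e"
  unfolding AutfL_def
proof (induction rule: generate.induct)
  case one
  obtain c where c: "c \<in> e" using e_nonempty by blast
  have "app \<kappa> \<alpha> (\<lambda>x\<in>univ C. x) c = c"
    using c by (intro app_eqI) (simp_all add: e_univ)
  then have "(\<lambda>x\<in>univ C. x) \<in> Aut\<^sub>e"
    using Aut\<^sub>eI[OF Aut_id[OF struct] c] c by (simp only:)
  then show ?case by (simp only: BijGroup_def monoid.simps)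
next
  case (inv h)
  then have "h \<in> Aut\<^sub>e" by blast
  then show ?case using Aut\<^sub>e_inv inv_BijGroup[OF Aut_Bij[OF Aut\<^sub>e_Aut]] by metis
next
  case (eng f g)
  then show ?case
    using Aut\<^sub>e_compose Aut_Bij[OF Aut\<^sub>e_Aut] by (simp add: BijGroup_def)
qed auto

lemma Autf_Aut: "f \<in> Autf \<Longrightarrow> f \<in> Aut L C"
  using Autf_subset Aut\<^sub>e_Aut by blast

lemma Autf_compose:
  assumes "f \<in> Autf" "g \<in> Autf"
  shows "compose (univ C) f g \<in> Autf"
proof -
  have "f \<otimes>\<^bsub>BijGroup (univ C)\<^esub> g \<in> Autf"
    using assms unfolding AutfL_def by (rule generate.eng)
  then show ?thesis using assms[THEN Autf_Aut, THEN Aut_Bij] by (simp add: BijGroup_def)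
qed

lemma Autf_inv: "f \<in> Autf \<Longrightarrow> Aut_inv C f \<in> Autf"
proof -
  assume f: "f \<in> Autf"
  interpret group "BijGroup (univ C)" by (rule group_BijGroup)
  have "inv\<^bsub>BijGroup (univ C)\<^esub> f \<in> Autf"
    using f Aut_Bij[OF Aut\<^sub>e_Aut] unfolding AutfL_def
    by (intro generate_m_inv_closed) (auto simp: BijGroup_def)
  then show ?thesis using inv_BijGroup Aut_Bij[OF Autf_Aut[OF f]] by metis
qed

text \<open>
  A representative \<^term>\<open>c\<close> of the hyperimaginary inside \<^term>\<open>M\<close> is the way to guarantee that
  \<^term>\<open>e\<close> is definable over \<^term>\<open>M\<close>.
\<close>

lemma Autf_if_fixes_model:
  assumes f: "f \<in> Aut L C" and M: "tarski_vaught M" "small \<kappa> M" and fixed: "\<And>x. x \<in> M \<Longrightarrow> f x = x"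
    and c: "c \<in> e" "c ` underS \<kappa> \<alpha> \<subseteq> M"
  shows "f \<in> Autf"
proof -
  have dcl: "g \<in> Aut\<^sub>e" if g: "g \<in> Aut L C" "\<forall>x\<in>M. g x = x" for g
  proof -
    have "app \<kappa> \<alpha> g c = c"
      using c g(2) by (intro app_eqI) auto
    then show ?thesis using Aut\<^sub>eI[OF g(1) c(1)] c(1) by simp
  qed
  then have "in_dcl L C \<kappa> \<alpha> e M" using Aut\<^sub>e_e unfolding in_dcl_def by blast
  then show ?thesis
    unfolding AutfL_def using elem_submodel_if_tarski_vaught[OF M(1)] M(2) fixed f dcl
    by (intro generate.incl) blast
qed

end

section \<open>Types over a model\<close>

text \<open>
  A model together with an enumeration by a set of indices of the type \<^typ>\<open>'k\<close>: this type is
  infinite, so there are enough variables \<open>x\<^sub>i\<close> and parameters to rename a formula into them,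
  even when the model is finite.
\<close>

locale enumerated_model = monster_over_hyperimaginary L T \<kappa> C \<alpha> e
  for L :: "('f, 'r) language" and T and \<kappa> :: "'k rel" and C :: "('f, 'r, 'a) fo_structure"
    and \<alpha> :: 'k and e :: "('k \<Rightarrow> 'a) set" +
  fixes M :: "'a set" and m :: "'k \<Rightarrow> 'a" and X :: "'k set"
  assumes model: "tarski_vaught M" and small_M: "small \<kappa> M"
    and small_X: "small \<kappa> X" and range_m: "m ` X = M"
    and dcl: "\<exists>c\<in>e. c ` underS \<kappa> \<alpha> \<subseteq> M"
begin

lemma M_univ: "M \<subseteq> univ C"
  using model by (simp add: tarski_vaught_def)

lemma m_univ: "i \<in> X \<Longrightarrow> m i \<in> univ C"
  using range_m M_univ by blast

definition assignment :: "('a \<Rightarrow> 'a) \<Rightarrow> 'k + 'a \<Rightarrow> 'a" where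
  "assignment h = case_sum (\<lambda>i. h (m i)) id"

lemma assignment_simps [simp]: "assignment h (Inl i) = h (m i)" "assignment h (Inr a) = a"
  by (simp_all add: assignment_def)

text \<open>
  \<open>type_of h\<close> is the type of \<open>h(M)\<close> over \<open>M\<close>.  A member of it is a formula in numbered variables
  with a list that substitutes indices and parameters for them.  Formulas with
  variables in \<^typ>\<open>'k + 'a\<close> do not form a small set, because any variable may occur bound.
\<close>

definition pretypes :: "(('f, 'r, nat) fm \<times> ('k + 'a) list) set" where
  "pretypes = {\<phi>. wf_fm L \<phi>} \<times> lists (Inl ` X \<union> Inr ` M)"

definition type_of :: "('a \<Rightarrow> 'a) \<Rightarrow> (('f, 'r, nat) fm \<times> ('k + 'a) list) set" where
  "type_of h = {(\<phi>, xs) \<in> pretypes. sat C (\<lambda>n. assignment h (xs ! n)) \<phi>}"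

lemma small_types: "small \<kappa> (Pow pretypes)"
  unfolding pretypes_def
  by (intro small_Pow small_Times small_formulas small_lists small_Un small_image small_X small_M)

lemma assignment_univ:
  assumes "h \<in> Aut L C"
  shows "assignment h ` (Inl ` X \<union> Inr ` M) \<subseteq> univ C"
  using Aut_mem[OF assms] m_univ M_univ by auto

lemma sat_if_same_type:
  fixes \<phi> :: "('f, 'r, nat) fm"
  assumes same: "type_of h = type_of h'" and \<phi>: "wf_fm L \<phi>" "w ` fv \<phi> \<subseteq> Inl ` X \<union> Inr ` M"
    and sat: "sat C (\<lambda>n. assignment h (w n)) \<phi>"
  shows "sat C (\<lambda>n. assignment h' (w n)) \<phi>"
proof -
  obtain a where a: "a \<in> M" using model by (auto simp: tarski_vaught_def)
  obtain l where l: "fv \<phi> \<subseteq> {..<l}" using finite_nat_iff_bounded finite_fv by blast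
  \<comment> \<open>Positions that are not free variables of \<open>\<phi>\<close> are filled with an arbitrary parameter.\<close>
  let ?xs = "map (\<lambda>n. if n \<in> fv \<phi> then w n else Inr a) [0..<l]"
  have eq: "sat C (\<lambda>n. assignment k (?xs ! n)) \<phi> \<longleftrightarrow> sat C (\<lambda>n. assignment k (w n)) \<phi>" for k
    by (rule sat_cong) (use l in auto)
  have "(if n \<in> fv \<phi> then w n else Inr a) \<in> Inl ` X \<union> Inr ` M" for n
    using subsetD[OF \<phi>(2), of "w n"] a by simp
  then have "?xs \<in> lists (Inl ` X \<union> Inr ` M)" unfolding in_lists_conv_set set_map by blast
  then have "(\<phi>, ?xs) \<in> pretypes" using \<phi>(1) by (simp add: pretypes_def)
  then have "(\<phi>, ?xs) \<in> type_of h" using sat eq by (simp add: type_of_def)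
  then have "(\<phi>, ?xs) \<in> type_of h'" using same by simp
  then show ?thesis using eq by (simp add: type_of_def)
qed

lemma conjugate_if_same_type:
  assumes "type_of h = type_of h'" "h \<in> Aut L C" "h' \<in> Aut L C"
  obtains k where "k \<in> Aut L C" "\<And>x. x \<in> M \<Longrightarrow> k x = x" "\<And>x. x \<in> M \<Longrightarrow> k (h x) = h' x"
proof -
  let ?V = "Inl ` X \<union> Inr ` M"
  have V: "small \<kappa> ?V" by (intro small_Un small_image small_X small_M)
  obtain k where k: "k \<in> Aut L C" "\<And>x. x \<in> ?V \<Longrightarrow> k (assignment h x) = assignment h' x"
    using ex_automorphism[OF V assignment_univ[OF assms(2)] assignment_univ[OF assms(3)]
        sat_if_same_type[OF assms(1)]] by metis
  have "k x = x" if "x \<in> M" for x using k(2)[of "Inr x"] that by simp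
  moreover have "k (h x) = h' x" if x: "x \<in> M" for x
  proof -
    obtain i where "i \<in> X" "x = m i" using x range_m by blast
    then show ?thesis using k(2)[of "Inl i"] by simp
  qed
  ultimately show thesis using that k(1) by blast
qed

text \<open>
  If for every finite part \<open>S'\<close> of \<open>S\<close> some automorphism that fixes \<open>S'\<close> sends \<open>M\<close> to a
  realization of the type of \<open>h(M)\<close>, then the type of \<open>h(M)\<close> over \<open>M\<close> is finitely satisfiable
  together with the type of \<open>M\<close> over \<open>S\<close>.  A common realization is \<open>h'(M)\<close> for
  an automorphism \<open>h'\<close> that fixes \<open>S\<close>.
\<close>

lemma compactness_fixing:
  assumes h: "h \<in> Aut L C" and S: "S \<subseteq> univ C" "small \<kappa> S"
    and fin: "\<And>S'. S' \<subseteq> S \<Longrightarrow> finite S' \<Longrightarrow>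
      \<exists>h'\<in>Aut L C. (\<forall>s\<in>S'. h' s = s) \<and> type_of h' = type_of h"
  obtains h' k where "h' \<in> Aut L C" "\<And>s. s \<in> S \<Longrightarrow> h' s = s"
    "k \<in> Aut L C" "\<And>x. x \<in> M \<Longrightarrow> k x = x" "\<And>x. x \<in> M \<Longrightarrow> k (h x) = h' x"
proof -
  let ?p1 = "{\<phi> :: ('f, 'r, 'k + 'a) fm. wf_fm L \<phi> \<and> fv \<phi> \<subseteq> Inl ` X \<union> Inr ` S \<and>
    sat C (assignment id) \<phi>}"
  let ?p2 = "{\<phi> :: ('f, 'r, 'k + 'a) fm. wf_fm L \<phi> \<and> fv \<phi> \<subseteq> Inl ` X \<union> Inr ` M \<and>
    sat C (assignment h) \<phi>}"
  have "infinite (UNIV :: 'k set)" by (rule infinite_super[OF subset_UNIV infinite_Field])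
  then have inf: "infinite (UNIV :: ('k + 'a) set)" by simp
  have "solutions C X p0 \<noteq> {}" if p0: "p0 \<subseteq> ?p1 \<union> ?p2" "finite p0" for p0
  proof -
    \<comment> \<open>Only the parameters that occur in \<open>p0\<close> have to be fixed.\<close>
    let ?S' = "S \<inter> {a. \<exists>\<phi>\<in>p0. Inr a \<in> fv \<phi>}"
    have "{a. \<exists>\<phi>\<in>p0. Inr a \<in> fv \<phi>} = (\<Union>\<phi>\<in>p0. Inr -` fv \<phi>)" by auto
    moreover have "finite (\<Union>\<phi>\<in>p0. Inr -` fv \<phi> :: 'a set)"
      using p0(2) by (intro finite_UN_I finite_vimageI) auto
    ultimately have "finite ?S'" by simp
    then obtain h' where h': "h' \<in> Aut L C" "\<And>s. s \<in> ?S' \<Longrightarrow> h' s = s" "type_of h' = type_of h"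
      using fin[of ?S'] by blast
    obtain k where k: "k \<in> Aut L C" "\<And>x. x \<in> M \<Longrightarrow> k x = x" "\<And>x. x \<in> M \<Longrightarrow> k (h x) = h' x"
      using conjugate_if_same_type[OF h'(3)[symmetric] h h'(1)] by blast
    let ?b = "\<lambda>i\<in>X. h' (m i)"
    have "sat C (case_sum ?b id) \<phi>" if \<phi>: "\<phi> \<in> p0" for \<phi>
    proof (cases "\<phi> \<in> ?p1")
      case True
      then have "assignment id ` fv \<phi> \<subseteq> univ C" using S(1) m_univ by fastforce
      then have "sat C (\<lambda>x. h' (assignment id x)) \<phi>"
        using True sat_Aut[OF struct h'(1)] by blast
      moreover have "sat C (case_sum ?b id) \<phi> \<longleftrightarrow> sat C (\<lambda>x. h' (assignment id x)) \<phi>"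
      proof (rule sat_cong)
        fix x assume x: "x \<in> fv \<phi>"
        then have "x \<in> Inl ` X \<union> Inr ` S" using True by blast
        moreover have "h' s = s" if "s \<in> S" "Inr s \<in> fv \<phi>" for s
          using h'(2)[of s] that \<phi> by blast
        ultimately show "case_sum ?b id x = h' (assignment id x)" using x by auto
      qed
      ultimately show ?thesis by blast
    next
      case False
      then have 2: "\<phi> \<in> ?p2" using \<phi> p0(1) by blast
      then have "assignment h ` fv \<phi> \<subseteq> univ C" using assignment_univ[OF h] by blast
      then have "sat C (\<lambda>x. k (assignment h x)) \<phi>" using 2 sat_Aut[OF struct k(1)] by blast
      moreover have "sat C (case_sum ?b id) \<phi> \<longleftrightarrow> sat C (\<lambda>x. k (assignment h x)) \<phi>"
      proof (rule sat_cong)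
        fix x assume "x \<in> fv \<phi>"
        then have "x \<in> Inl ` X \<union> Inr ` M" using 2 by blast
        then show "case_sum ?b id x = k (assignment h x)"
          using k(2,3) range_m by auto
      qed
      ultimately show ?thesis by blast
    qed
    moreover have "?b \<in> X \<rightarrow>\<^sub>E univ C" using m_univ Aut_mem[OF h'(1)] by auto
    ultimately have "?b \<in> solutions C X p0" unfolding solutions_def by blast
    then show ?thesis by blast
  qed
  then have "partial_type_over L C X (S \<union> M) (?p1 \<union> ?p2)"
    unfolding partial_type_over_def by blast
  then obtain b where b: "b \<in> solutions C X (?p1 \<union> ?p2)"
    using ex_realization[OF small_X _ small_Un[OF S(2) small_M]] S(1) M_univ by blast
  then have b_univ: "\<And>i. i \<in> X \<Longrightarrow> b i \<in> univ C" by (auto simp: solutions_def)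
  have transfer: "sat C (\<lambda>n. case_sum b id (w n)) \<phi>"
    if \<phi>: "wf_fm L \<phi>" "w ` fv \<phi> \<subseteq> Inl ` X \<union> Inr ` A" "sat C (\<lambda>n. assignment g (w n)) \<phi>"
      "(g = id \<and> A = S) \<or> (g = h \<and> A = M)"
    for \<phi> :: "('f, 'r, nat) fm" and w g A
  proof -
    obtain \<psi> :: "('f, 'r, 'k + 'a) fm" where \<psi>: "wf_fm L \<psi>" "fv \<psi> = w ` fv \<phi>"
      "\<And>u. sat C u \<psi> \<longleftrightarrow> sat C (\<lambda>n. u (w n)) \<phi>"
      using ex_substitution[OF inf \<phi>(1), of w C] by blast
    then have "\<psi> \<in> ?p1 \<union> ?p2" using \<phi>(2-4) by auto
    then have "sat C (case_sum b id) \<psi>" using b unfolding solutions_def by blast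
    then show ?thesis by (simp only: \<psi>(3))
  qed
  have VS: "small \<kappa> (Inl ` X \<union> Inr ` S)" "assignment id ` (Inl ` X \<union> Inr ` S) \<subseteq> univ C"
    "case_sum b id ` (Inl ` X \<union> Inr ` S) \<subseteq> univ C"
    using S m_univ b_univ by (auto intro!: small_Un small_image small_X)
  obtain h' where h': "h' \<in> Aut L C"
    "\<And>x. x \<in> Inl ` X \<union> Inr ` S \<Longrightarrow> h' (assignment id x) = case_sum b id x"
    using ex_automorphism[OF VS] transfer by blast
  have VM: "small \<kappa> (Inl ` X \<union> Inr ` M)" "case_sum b id ` (Inl ` X \<union> Inr ` M) \<subseteq> univ C"
    using M_univ b_univ by (auto intro!: small_Un small_image small_X small_M)
  obtain k where k: "k \<in> Aut L C"
    "\<And>x. x \<in> Inl ` X \<union> Inr ` M \<Longrightarrow> k (assignment h x) = case_sum b id x"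
    using ex_automorphism[OF VM(1) assignment_univ[OF h] VM(2)] transfer by blast
  have "k (h x) = h' x" if x: "x \<in> M" for x
  proof -
    obtain i where "i \<in> X" "x = m i" using x range_m by blast
    then show ?thesis using k(2)[of "Inl i"] h'(2)[of "Inl i"] by simp
  qed
  moreover have "h' s = s" if "s \<in> S" for s using h'(2)[of "Inr s"] that by simp
  moreover have "k x = x" if "x \<in> M" for x using k(2)[of "Inr x"] that by simp
  ultimately show thesis using that h'(1) k(1) by blast
qed

text \<open>
  The composition \<open>k h h'\<inverse>\<close> fixes the model \<open>h'(M)\<close> pointwise.  This model contains a representative
  of \<open>e\<close>, because \<open>h'\<close> acts on the one in \<open>M\<close> as \<open>k h\<close> does, which fixes \<open>e\<close>.  So \<open>h h'\<inverse>\<close> is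
  a product of two automorphisms that fix models.
\<close>

lemma quotient_in_Autf:
  assumes h: "h \<in> Aut\<^sub>e" and h': "h' \<in> Aut L C" and k: "k \<in> Aut L C"
    and kM: "\<And>x. x \<in> M \<Longrightarrow> k x = x" and conj: "\<And>x. x \<in> M \<Longrightarrow> k (h x) = h' x"
  shows "compose (univ C) h (Aut_inv C h') \<in> Autf"
proof -
  let ?q = "compose (univ C) h (Aut_inv C h')"
  let ?F = "compose (univ C) k ?q"
  obtain c where c: "c \<in> e" "c ` underS \<kappa> \<alpha> \<subseteq> M" using dcl by blast
  have kf: "k \<in> Autf" by (rule Autf_if_fixes_model[OF k model small_M kM c])
  have q: "?q \<in> Aut L C" using Aut_compose[OF struct] Aut\<^sub>e_Aut[OF h] Aut_inv[OF struct h'] by blast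
  have kq: "?F \<in> Aut L C" using Aut_compose[OF struct k q] .
  have "app \<kappa> \<alpha> h c \<in> e" using Aut\<^sub>e_e[OF h] c(1) by blast
  then have "app \<kappa> \<alpha> k (app \<kappa> \<alpha> h c) \<in> e" using Aut\<^sub>e_e[OF Autf_subset[OF kf]] by blast
  moreover have "app \<kappa> \<alpha> h' c = app \<kappa> \<alpha> k (app \<kappa> \<alpha> h c)"
    using c(2) conj by (auto simp: compose_def fun_eq_iff restrict_def)
  ultimately have c': "app \<kappa> \<alpha> h' c \<in> e" by simp
  have c'_range: "app \<kappa> \<alpha> h' c ` underS \<kappa> \<alpha> \<subseteq> h' ` M"
    using c(2) by (auto simp: compose_def)
  have "?F y = y" if y: "y \<in> h' ` M" for y
  proof -
    obtain x where x: "x \<in> M" "y = h' x" using y by blast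
    then have "x \<in> univ C" "h' x \<in> univ C" using M_univ Aut_mem[OF h'] by blast+
    then show ?thesis
      using x conj by (simp add: compose_eq Aut_inverse(1)[OF h'] del: restrict_apply)
  qed
  then have "?F \<in> Autf"
    by (intro Autf_if_fixes_model[OF kq tarski_vaught_image[OF model h'] small_image[OF small_M] _ c' c'_range])
  then have "compose (univ C) (Aut_inv C k) ?F \<in> Autf" using Autf_compose Autf_inv[OF kf] by blast
  moreover have "compose (univ C) (Aut_inv C k) ?F = ?q"
  proof (rule extensionalityI[of _ "univ C"])
    fix x assume "x \<in> univ C"
    then show "compose (univ C) (Aut_inv C k) ?F x = ?q x"
      using Aut_mem[OF q] by (simp add: compose_eq Aut_inverse(1)[OF k] del: restrict_apply)
  qed simp_all
  ultimately show ?thesis by simp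
qed

text \<open>
  Call a type over \<^term>\<open>M\<close> bad if, for some finite part \<open>S'\<close> of \<^term>\<open>U\<close>, it is not the type of any
  \<open>h'(M)\<close> with \<open>h'\<close> fixing \<open>S'\<close>.  The set \<open>S\<^sub>0\<close> collects one such finite part for each bad type.
  If \<open>f\<close> agrees on \<open>S\<^sub>0\<close> with a Lascar strong \<open>g\<close>, then \<open>h = g\<inverse> f\<close> fixes \<open>S\<^sub>0\<close>, so the type of
  \<open>h(M)\<close> is not bad, and by compactness it is the type of \<open>h'(M)\<close> for some \<open>h'\<close> that
  fixes any given small \<open>S\<close>.  Then \<open>g h h'\<inverse>\<close> agrees with \<open>f\<close> on \<open>S\<close>, and \<open>h h'\<inverse>\<close> is Lascar strong.
\<close>

lemma ex_small_determining_set: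
  assumes U: "U \<subseteq> univ C"
  obtains S\<^sub>0 where "S\<^sub>0 \<subseteq> U" "small \<kappa> S\<^sub>0"
    "\<forall>f\<in>Aut\<^sub>e. (\<exists>g\<in>Autf. \<forall>s\<in>S\<^sub>0. g s = f s) \<longrightarrow>
      (\<forall>S. S \<subseteq> U \<and> small \<kappa> S \<longrightarrow> (\<exists>g\<in>Autf. \<forall>s\<in>S. g s = f s))"
proof -
  define bad where "bad q S' \<longleftrightarrow> S' \<subseteq> U \<and> finite S' \<and>
    (\<forall>h'\<in>Aut L C. (\<forall>s\<in>S'. h' s = s) \<longrightarrow> type_of h' \<noteq> q)" for q S'
  define N where "N q = (if \<exists>S'. bad q S' then SOME S'. bad q S' else {})" for q
  have N: "bad q (N q)" if "bad q S'" for q S'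
    using someI_ex[of "bad q"] that unfolding N_def by auto
  have N': "N q \<subseteq> U" "finite (N q)" for q
  proof -
    have "bad q (N q) \<or> N q = {}"
    proof (cases "\<exists>S'. bad q S'")
      case True
      then show ?thesis using N by blast
    qed (simp add: N_def)
    then show "N q \<subseteq> U" "finite (N q)" unfolding bad_def by auto
  qed
  let ?S0 = "\<Union>q\<in>Pow pretypes. N q"
  have S0: "?S0 \<subseteq> U" "small \<kappa> ?S0"
    using N'(1) by (blast, intro small_UN_finite[OF small_types N'(2)])
  have determining: "\<exists>g'\<in>Autf. \<forall>s\<in>S. g' s = f s"
    if f: "f \<in> Aut\<^sub>e" and g: "g \<in> Autf" and agree: "\<forall>s\<in>?S0. g s = f s"
      and S: "S \<subseteq> U" "small \<kappa> S" for f g S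
  proof -
    let ?h = "compose (univ C) (Aut_inv C g) f"
    have h: "?h \<in> Aut\<^sub>e" using Aut\<^sub>e_compose Aut\<^sub>e_inv Autf_subset f g by blast
    have gh: "g (?h x) = f x" if "x \<in> univ C" for x
      using that Aut_inverse(2)[OF Autf_Aut[OF g]] Aut_mem[OF Aut\<^sub>e_Aut[OF f]]
      by (simp add: compose_eq del: restrict_apply)
    have h_fixes: "?h s = s" if "s \<in> ?S0" for s
    proof -
      have s: "s \<in> univ C" using that S0(1) U by blast
      then have "?h s = Aut_inv C g (g s)"
        using bspec[OF agree that] by (simp add: compose_eq del: restrict_apply)
      then show ?thesis using Aut_inverse(1)[OF Autf_Aut[OF g] s] by simp
    qed
    have "type_of ?h \<in> Pow pretypes" by (auto simp: type_of_def)
    then have "\<not> bad (type_of ?h) (N (type_of ?h))"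
      using h_fixes Aut\<^sub>e_Aut[OF h] unfolding bad_def by blast
    then have not_bad: "\<not> bad (type_of ?h) S'" for S' using N by blast
    have fin: "\<exists>h'\<in>Aut L C. (\<forall>s\<in>S'. h' s = s) \<and> type_of h' = type_of ?h"
      if S': "S' \<subseteq> S" "finite S'" for S'
    proof -
      have "S' \<subseteq> U" using S'(1) S(1) by (rule subset_trans)
      then show ?thesis using S'(2) not_bad[of S'] unfolding bad_def by metis
    qed
    obtain h' k where h': "h' \<in> Aut L C" "\<And>s. s \<in> S \<Longrightarrow> h' s = s"
      and k: "k \<in> Aut L C" "\<And>x. x \<in> M \<Longrightarrow> k x = x" "\<And>x. x \<in> M \<Longrightarrow> k (?h x) = h' x"
      by (rule compactness_fixing[OF Aut\<^sub>e_Aut[OF h] subset_trans[OF S(1) U] S(2)])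
        (rule fin, assumption+, rule that)
    let ?q = "compose (univ C) ?h (Aut_inv C h')"
    have "compose (univ C) g ?q \<in> Autf"
      using Autf_compose[OF g quotient_in_Autf[OF h h'(1) k]] .
    moreover have "compose (univ C) g ?q s = f s" if "s \<in> S" for s
    proof -
      have s: "s \<in> univ C" using that S(1) U by blast
      have "Aut_inv C h' s = s" using Aut_inverse(1)[OF h'(1) s] h'(2)[OF that] by simp
      then have "?q s = ?h s" using s by (simp only: compose_eq)
      then show ?thesis using gh[OF s] s by (simp only: compose_eq)
    qed
    ultimately show ?thesis by blast
  qed
  show thesis
    by (rule that[OF S0], intro ballI impI allI, elim bexE conjE, rule determining)
qed

end

section \<open>Lascar tuples\<close>

context monster_over_hyperimaginary
begin

lemma ex_enumerated_model:
  assumes "small_ordinal \<kappa> \<alpha>"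
  obtains M m X where "enumerated_model L T \<kappa> C \<alpha> e M m X"
proof -
  obtain c where c: "c \<in> e" using e_nonempty by blast
  have "c ` underS \<kappa> \<alpha> \<subseteq> univ C" using e_univ[OF c] by blast
  moreover have "small \<kappa> (c ` underS \<kappa> \<alpha>)"
    using card_of_underS[OF card] assms by (intro small_image) (simp add: small_def small_ordinal_def)
  ultimately obtain M where M: "c ` underS \<kappa> \<alpha> \<subseteq> M" "small \<kappa> M" "tarski_vaught M"
    using ex_tarski_vaught by blast
  obtain m X where "X \<subseteq> Field \<kappa>" "small \<kappa> X" "bij_betw m X M" using small_index[OF M(2)] .
  then have "enumerated_model L T \<kappa> C \<alpha> e M m X"
    using M c by unfold_locales (auto simp: bij_betw_def)
  then show thesis using that by blast
qed

lemma small_underS: "i \<in> Field \<kappa> \<Longrightarrow> small \<kappa> (underS \<kappa> i)"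
  using card_of_underS[OF card] by (simp add: small_def)

text \<open>
  Lascar equivalence of a tuple with its image under \<open>f\<close> depends only on the set of elements
  that occur in the tuple, not on the way they are arranged.
\<close>

lemma lascar_equiv_iff:
  assumes "b \<in> tuples \<kappa> \<mu> (realizations C \<kappa> \<beta> p)" "\<sigma> = restrict (app \<kappa> \<beta> f) (realizations C \<kappa> \<beta> p)"
  shows "lascar_equiv L C \<kappa> \<alpha> e \<beta> \<mu> b (app \<kappa> \<mu> \<sigma> b) \<longleftrightarrow>
    (\<exists>g\<in>Autf. \<forall>i\<in>underS \<kappa> \<mu>. \<forall>j\<in>underS \<kappa> \<beta>. g (b i j) = f (b i j))"
proof -
  have "app \<kappa> \<mu> (app \<kappa> \<beta> g) b = app \<kappa> \<mu> \<sigma> b \<longleftrightarrow>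
      (\<forall>i\<in>underS \<kappa> \<mu>. \<forall>j\<in>underS \<kappa> \<beta>. g (b i j) = f (b i j))" (is "?l \<longleftrightarrow> ?r") for g
  proof
    have b: "\<sigma> (b i) = app \<kappa> \<beta> f (b i)" if "i \<in> underS \<kappa> \<mu>" for i
      using that assms by (simp add: PiE_iff)
    show ?r if ?l
    proof (intro ballI)
      fix i j assume ij: "i \<in> underS \<kappa> \<mu>" "j \<in> underS \<kappa> \<beta>"
      have "app \<kappa> \<beta> g (b i) = app \<kappa> \<beta> f (b i)"
        using fun_cong[OF that, of i] b[OF ij(1)] ij(1) by (simp add: compose_eq)
      then show "g (b i j) = f (b i j)" using fun_cong[of _ _ j] ij(2) by (metis compose_eq)
    qed
    show ?l if ?r
    proof (rule extensionalityI[of _ "underS \<kappa> \<mu>"])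
      fix i assume i: "i \<in> underS \<kappa> \<mu>"
      have "app \<kappa> \<beta> g (b i) = app \<kappa> \<beta> f (b i)"
        using that i by (intro extensionalityI[of _ "underS \<kappa> \<beta>"]) (simp_all add: compose_eq)
      then show "app \<kappa> \<mu> (app \<kappa> \<beta> g) b i = app \<kappa> \<mu> \<sigma> b i" using i b by (simp add: compose_eq)
    qed simp_all
  qed
  then show ?thesis unfolding lascar_equiv_def by simp
qed

text \<open>
  The determining set consists of elements of the monster model.  Choosing for each of them a
  realization in which it occurs as a coordinate yields the tuple of realizations.
\<close>

lemma ex_lascar_tuple:
  assumes p: "partial_type L C \<kappa> \<beta> p"
  shows "\<exists>\<mu> b. lascar_tuple L C \<kappa> \<alpha> e \<beta> p \<mu> b"
proof -
  let ?R = "realizations C \<kappa> \<beta> p"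
  let ?U = "\<Union>c\<in>?R. c ` underS \<kappa> \<beta>"
  have \<beta>: "\<beta> \<in> Field \<kappa>" using p by (auto simp: partial_type_def small_ordinal_def)
  have U: "?U \<subseteq> univ C" by (auto simp: solutions_def)
  have "small_ordinal \<kappa> \<alpha>" using hyperimaginary by (simp add: hyperimaginary_def)
  then obtain M m X where "enumerated_model L T \<kappa> C \<alpha> e M m X" using ex_enumerated_model by blast
  then interpret enumerated_model L T \<kappa> C \<alpha> e M m X .
  obtain S\<^sub>0 where S0: "S\<^sub>0 \<subseteq> ?U" "small \<kappa> S\<^sub>0"
    and determining: "\<forall>f\<in>Aut\<^sub>e. (\<exists>g\<in>Autf. \<forall>s\<in>S\<^sub>0. g s = f s) \<longrightarrow>
      (\<forall>S. S \<subseteq> ?U \<and> small \<kappa> S \<longrightarrow> (\<exists>g\<in>Autf. \<forall>s\<in>S. g s = f s))"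
    using ex_small_determining_set[OF U] .
  have "\<forall>s\<in>S\<^sub>0. \<exists>c\<in>?R. s \<in> c ` underS \<kappa> \<beta>" using S0(1) by blast
  then obtain r where r: "\<And>s. s \<in> S\<^sub>0 \<Longrightarrow> r s \<in> ?R \<and> s \<in> r s ` underS \<kappa> \<beta>" by metis
  obtain \<mu> t where \<mu>: "small_cardinal \<kappa> \<mu>" "bij_betw t (underS \<kappa> \<mu>) (r ` S\<^sub>0)"
    using small_enumeration[OF small_image[OF S0(2)]] .
  let ?b = "restrict t (underS \<kappa> \<mu>)"
  have "t i \<in> r ` S\<^sub>0" if "i \<in> underS \<kappa> \<mu>" for i using bij_betw_apply[OF \<mu>(2) that] .
  then have "t i \<in> ?R" if "i \<in> underS \<kappa> \<mu>" for i using r that by (metis imageE)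
  then have b: "?b \<in> tuples \<kappa> \<mu> ?R" by simp
  have "lascar_equiv L C \<kappa> \<alpha> e \<beta> \<nu> d (app \<kappa> \<nu> \<sigma> d)"
    if \<sigma>: "\<sigma> \<in> Aut_type L C \<kappa> \<alpha> e \<beta> p" "lascar_equiv L C \<kappa> \<alpha> e \<beta> \<mu> ?b (app \<kappa> \<mu> \<sigma> ?b)"
      and \<nu>: "small_cardinal \<kappa> \<nu>" and d: "d \<in> tuples \<kappa> \<nu> ?R" for \<sigma> \<nu> d
  proof -
    obtain f where f: "f \<in> Aut\<^sub>e" "\<sigma> = restrict (app \<kappa> \<beta> f) ?R"
      using \<sigma>(1) by (auto simp: Aut_type_def)
    obtain g where g: "g \<in> Autf" "\<And>i j. i \<in> underS \<kappa> \<mu> \<Longrightarrow> j \<in> underS \<kappa> \<beta> \<Longrightarrow> g (?b i j) = f (?b i j)"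
      using \<sigma>(2) unfolding lascar_equiv_iff[OF b f(2)] by blast
    have agree: "g s = f s" if s: "s \<in> S\<^sub>0" for s
    proof -
      obtain j where j: "j \<in> underS \<kappa> \<beta>" "s = r s j" using r[OF s] by blast
      obtain i where "i \<in> underS \<kappa> \<mu>" "t i = r s"
        using s bij_betw_imp_surj_on[OF \<mu>(2)] by (metis imageE imageI)
      then show ?thesis using g(2)[of i j] j by simp
    qed
    let ?S = "(\<lambda>(i, j). d i j) ` (underS \<kappa> \<nu> \<times> underS \<kappa> \<beta>)"
    have "?S \<subseteq> ?U" using d by (force simp: PiE_iff)
    moreover have "small \<kappa> ?S"
      using \<nu> \<beta> by (intro small_image small_Times small_underS)
        (simp_all add: small_cardinal_def small_ordinal_def)
    ultimately obtain g' where "g' \<in> Autf" "\<forall>s\<in>?S. g' s = f s"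
      using bspec[OF determining f(1)] agree g(1) by metis
    then show ?thesis unfolding lascar_equiv_iff[OF d f(2)] by (intro bexI[of _ g']) auto
  qed
  then have "AutfL_type L C \<kappa> \<alpha> e \<beta> p =
      {\<sigma> \<in> Aut_type L C \<kappa> \<alpha> e \<beta> p. lascar_equiv L C \<kappa> \<alpha> e \<beta> \<mu> ?b (app \<kappa> \<mu> \<sigma> ?b)}"
    unfolding AutfL_type_def using \<mu>(1) b by blast
  then show ?thesis unfolding lascar_tuple_def using \<mu>(1) b by blast
qed

end

theorem lemma2p2:
  fixes L :: "('f, 'r) language"
    and T :: "('f, 'r, nat) fm set"
    and \<kappa> :: "'k rel"
    and C :: "('f, 'r, 'a) fo_structure"
    and \<alpha> \<beta> :: 'k
    and e :: "('k \<Rightarrow> 'a) set"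
    and p :: "('f, 'r, 'k + 'a) fm set"
  assumes "complete_theory L T"
    and "monster_model L T \<kappa> C"
    and "hyperimaginary L C \<kappa> \<alpha> e"
    and "partial_type L C \<kappa> \<beta> p"
    and "invariant_type L C \<kappa> \<alpha> e \<beta> p"
  shows "\<exists>\<mu> b. lascar_tuple L C \<kappa> \<alpha> e \<beta> p \<mu> b"
proof -
  interpret monster_over_hyperimaginary L T \<kappa> C \<alpha> e
    using assms(1-3) by unfold_locales
  show ?thesis using assms(4) by (rule ex_lascar_tuple)
qed

end
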